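(* The Maslov index is a well defined function $\mathrm{mas}:\mathcal{P}(2d)\to\mathbb{Z}$, i.e. $\mathrm{mas}(\Gamma)=\mathrm{ind}(h)-dk$ is independent of the chosen (sufficiently large) parameter $k$ used to define it. Moreover, it is a lower semi-continuous function on $\mathcal{P}(2d)$, and it is locally constant on every subspace $\mathcal{P}_n(2d)$, $n=0,\dots,2d$. The same properties hold for the Maslov coindex $\mathrm{comas}(\Gamma)=\mathrm{coind}(h)-dk$.
   Context: $\mathrm{Sp}(2d)$ is the group of real symplectic matrices of $\mathbb{R}^{2d}\ni(x,y)$ with $\omega=dx\wedge dy$. $\mathcal{P}(2d)$ is the space of continuous paths $\Gamma:[0,1]\to\mathrm{Sp}(2d)$ with $\Gamma(0)=I$, with the $C^0$-topology, and $\mathcal{P}_n(2d)=\{\Gamma\in\mathcal{P}(2d)\mid\dim\ker(\Gamma(1)-I)=n\}$ with the subspace topology. A matrix $P_j\in\mathrm{Sp}(2d)$ is described by the quadratic generating function $f_j(X,Y)=\tfrac12\langle A_jX,X\rangle+\langle B_jX,Y\rangle+\tfrac12\langle C_jY,Y\rangle$ (with $A_j,C_j$ symmetric and $B_j$ arbitrary real $d\times d$ matrices) if $P_j(X_j,Y_j)=(X_{j+1},Y_{j+1})$ if and only if $X_{j+1}-X_j=-B_jX_{j+1}-C_jY_j$ and $Y_{j+1}-Y_j=A_jX_{j+1}+B_j^TY_j$; this holds for all symplectic matrices sufficiently close to the identity. Given $\Gamma\in\mathcal{P}(2d)$, choose $k\in\mathbb{N}$ large enough, meaning that for all $t_1,t_2\in[0,1]$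 with $|t_1-t_2|\leq1/k$ the matrix $\Gamma(t_2)\Gamma(t_1)^{-1}$ is close enough to the identity to be described by a quadratic generating function. Set $P_j:=\Gamma(\tfrac{j+1}k)\Gamma(\tfrac jk)^{-1}$ for $j=0,\dots,k-1$, with quadratic generating functions $f_j$, and let $h:\mathbb{R}^{2dk}\times\mathbb{R}^{2dk}\to\mathbb{R}$ be the symmetric bilinear form with $$\tfrac12h(\boldsymbol Z,\boldsymbol Z)=\sum_{j\in\mathbb{Z}_k}\big(\langle Y_j,X_{j+1}-X_j\rangle+f_j(X_{j+1},Y_j)\big),\qquad\boldsymbol Z=(X_0,Y_0,\dots,X_{k-1},Y_{k-1}).$$ $\mathrm{ind}(h)$ and $\mathrm{coind}(h)$ are the maximal dimensions of subspaces on which $h$ is negative, respectively positive, definite. The Maslov index and coindex are $\mathrm{mas}(\Gamma):=\mathrm{ind}(h)-dk$ and $\mathrm{comas}(\Gamma):=\mathrm{coind}(h)-dk$. *)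

theory Defs
  imports "HOL-Analysis.Analysis" "HOL-Analysis.Finite_Function_Topology"
begin

text \<open>
  Phase space is \<open>real ^ ('d + 'd)\<close> with \<open>d = CARD('d)\<close>: the coordinates indexed by
  \<open>Inl\<close> are the \<open>x\<close>-coordinates, those indexed by \<open>Inr\<close> the \<open>y\<close>-coordinates.
\<close>

type_synonym 'd phase = "real ^ ('d + 'd)"
type_synonym 'd phase_mat = "real ^ ('d + 'd) ^ ('d + 'd)"

definition xpart :: "'d::finite phase \<Rightarrow> real ^ 'd" where
  "xpart z = (\<chi> i. z $ Inl i)"

definition ypart :: "'d::finite phase \<Rightarrow> real ^ 'd" where
  "ypart z = (\<chi> i. z $ Inr i)"

definition omega :: "'d::finite phase \<Rightarrow> 'd phase \<Rightarrow> real" where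
  "omega v w = xpart v \<bullet> ypart w - ypart v \<bullet> xpart w"

definition Sp :: "'d::finite phase_mat set" where
  "Sp = {M. \<forall>v w. omega (M *v v) (M *v w) = omega v w}"


text \<open>
  Paths are functions on the unit interval; following \<^const>\<open>cfunspace\<close>, they are represented
  by functions on \<^typ>\<open>real\<close> that take the value \<^const>\<open>undefined\<close> outside of it.
  The metric of \<^const>\<open>cfunspace\<close> is the supremum metric.
\<close>

definition symplectic_paths :: "(real \<Rightarrow> 'd::finite phase_mat) set" where
  "symplectic_paths =
     {\<Gamma> \<in> mspace (cfunspace (top_of_set {0..1}) euclidean_metric).
        (\<forall>t\<in>{0..1}. \<Gamma> t \<in> Sp) \<and> \<Gamma> 0 = mat 1}"

definition path_topology :: "(real \<Rightarrow> 'd::finite phase_mat) topology" where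
  "path_topology =
     subtopology (mtopology_of (cfunspace (top_of_set {0..1}) euclidean_metric)) symplectic_paths"

definition symplectic_paths_nullity :: "nat \<Rightarrow> (real \<Rightarrow> 'd::finite phase_mat) set" where
  "symplectic_paths_nullity n =
     {\<Gamma> \<in> symplectic_paths. dim {v. (\<Gamma> 1 - mat 1) *v v = 0} = n}"


text \<open>A triple \<open>(A, B, C)\<close> stands for the quadratic generating function with these coefficients.\<close>

type_synonym 'd quad_gen = "(real ^ 'd ^ 'd) \<times> (real ^ 'd ^ 'd) \<times> (real ^ 'd ^ 'd)"

fun gen_value :: "'d::finite quad_gen \<Rightarrow> real ^ 'd \<Rightarrow> real ^ 'd \<Rightarrow> real" where
  "gen_value (A, B, C) X Y =
     1/2 * ((A *v X) \<bullet> X) + (B *v X) \<bullet> Y + 1/2 * ((C *v Y) \<bullet> Y)"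

fun generates :: "'d::finite quad_gen \<Rightarrow> 'd phase_mat \<Rightarrow> bool" where
  "generates (A, B, C) P \<longleftrightarrow>
     transpose A = A \<and> transpose C = C \<and>
     (\<forall>z z'. P *v z = z' \<longleftrightarrow>
        xpart z' - xpart z = - (B *v xpart z') - C *v ypart z \<and>
        ypart z' - ypart z = A *v xpart z' + transpose B *v ypart z)"

lemma generates_unique:
  fixes P :: "'d::finite phase_mat"
  assumes "generates F P" "generates G P"
  shows "F = G"
proof -
  obtain A B C where F: "F = (A, B, C)" by (cases F)
  obtain A' B' C' where G: "G = (A', B', C')" by (cases G)
  have eqs: "B *v X + C *v Y = B' *v X + C' *v Y"
            "A *v X + transpose B *v Y = A' *v X + transpose B' *v Y" for X Y
  proof -
    define z :: "'d phase" where
      "z = (\<chi> i. case i of Inl a \<Rightarrow> (X + (B *v X + C *v Y)) $ a | Inr b \<Rightarrow> Y $ b)"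
    define z' :: "'d phase" where
      "z' = (\<chi> i. case i of Inl a \<Rightarrow> X $ a | Inr b \<Rightarrow> (Y + (A *v X + transpose B *v Y)) $ b)"
    have xy: "xpart z = X + (B *v X + C *v Y)" "ypart z = Y" "xpart z' = X"
      "ypart z' = Y + (A *v X + transpose B *v Y)"
      by (simp_all add: xpart_def ypart_def z_def z'_def vec_eq_iff)
    have "P *v z = z'" using assms(1) unfolding F by (simp add: xy)
    then have "xpart z' - xpart z = - (B' *v xpart z') - C' *v ypart z \<and>
               ypart z' - ypart z = A' *v xpart z' + transpose B' *v ypart z"
      using assms(2) unfolding G by simp
    then show "B *v X + C *v Y = B' *v X + C' *v Y"
      "A *v X + transpose B *v Y = A' *v X + transpose B' *v Y"
      unfolding xy by (simp_all add: algebra_simps)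
  qed
  have "A = A'" using eqs(2)[of _ 0] by (simp add: matrix_eq)
  moreover have "B = B'" using eqs(1)[of _ 0] by (simp add: matrix_eq)
  moreover have "C = C'" using eqs(1)[of 0] by (simp add: matrix_eq)
  ultimately show ?thesis by (simp add: F G)
qed

definition gen_fun :: "'d::finite phase_mat \<Rightarrow> 'd quad_gen" where
  "gen_fun P = (THE F. generates F P)"

lemma gen_fun_eq: "generates F P \<Longrightarrow> gen_fun P = F"
  unfolding gen_fun_def using generates_unique by blast

lemma generates_gen_fun: "\<exists>F. generates F P \<Longrightarrow> generates (gen_fun P) P"
  using gen_fun_eq by metis


definition large_enough :: "(real \<Rightarrow> 'd::finite phase_mat) \<Rightarrow> nat \<Rightarrow> bool" where
  "large_enough \<Gamma> k \<longleftrightarrow>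
     k \<ge> 1 \<and>
     (\<forall>t1\<in>{0..1}. \<forall>t2\<in>{0..1}. \<bar>t1 - t2\<bar> \<le> 1 / real k \<longrightarrow>
        (\<exists>F. generates F (\<Gamma> t2 ** matrix_inv (\<Gamma> t1))))"

definition step_mat :: "(real \<Rightarrow> 'd::finite phase_mat) \<Rightarrow> nat \<Rightarrow> nat \<Rightarrow> 'd phase_mat" where
  "step_mat \<Gamma> k j =
     \<Gamma> (real (j + 1) / real k) ** matrix_inv (\<Gamma> (real j / real k))"


text \<open>
  As \<open>k\<close> varies, the space of all \<open>(Z\<^sub>0, \<dots>, Z\<^sub>k\<^sub>-\<^sub>1)\<close> with \<open>Z\<^sub>j = (X\<^sub>j, Y\<^sub>j)\<close> is represented by the
  \<open>2dk\<close>-dimensional subspace of those finitely supported sequences that vanish from index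
  \<open>k\<close> on.
\<close>

definition config_space :: "nat \<Rightarrow> (nat \<Rightarrow>\<^sub>0 'd::finite phase) set" where
  "config_space k = {Z. Poly_Mapping.keys Z \<subseteq> {..<k}}"

definition action :: "(real \<Rightarrow> 'd::finite phase_mat) \<Rightarrow> nat \<Rightarrow> (nat \<Rightarrow>\<^sub>0 'd phase) \<Rightarrow> real" where
  "action \<Gamma> k Z =
     (\<Sum>j<k. let X = \<lambda>i. xpart (Poly_Mapping.lookup Z (i mod k));
                 Y = \<lambda>i. ypart (Poly_Mapping.lookup Z (i mod k))
             in Y j \<bullet> (X (j + 1) - X j) + gen_value (gen_fun (step_mat \<Gamma> k j)) (X (j + 1)) (Y j))"

text \<open>Polarization of the quadratic form \<open>h(Z, Z) = 2 * action(Z)\<close>.\<close>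

definition hform ::
  "(real \<Rightarrow> 'd::finite phase_mat) \<Rightarrow> nat \<Rightarrow> (nat \<Rightarrow>\<^sub>0 'd phase) \<Rightarrow> (nat \<Rightarrow>\<^sub>0 'd phase) \<Rightarrow> real" where
  "hform \<Gamma> k Z W = action \<Gamma> k (Z + W) - action \<Gamma> k Z - action \<Gamma> k W"

lemma xpart_simps [simp]:
  "xpart (v + w) = xpart v + xpart w" "xpart (c *\<^sub>R v) = c *\<^sub>R xpart v"
  by (simp_all add: xpart_def vec_eq_iff)

lemma ypart_simps [simp]:
  "ypart (v + w) = ypart v + ypart w" "ypart (c *\<^sub>R v) = c *\<^sub>R ypart v"
  by (simp_all add: ypart_def vec_eq_iff)

lemma lookup_scaleR_poly_mapping:
  "Poly_Mapping.lookup (c *\<^sub>R Z) i = c *\<^sub>R Poly_Mapping.lookup (Z :: 'a \<Rightarrow>\<^sub>0 'b::real_vector) i"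
proof -
  have "finite {i. c *\<^sub>R Poly_Mapping.lookup Z i \<noteq> 0}"
    by (rule finite_subset[OF _ finite_lookup[of Z]]) auto
  then show ?thesis
    by (simp add: scaleR_poly_mapping_def)
qed

lemma hform_bilinear: "bilinear (hform \<Gamma> k)"
  and hform_sym: "hform \<Gamma> k Z W = hform \<Gamma> k W Z"
proof -
  show sym: "hform \<Gamma> k Z W = hform \<Gamma> k W Z" for Z W
    by (simp add: hform_def add.commute)
  define b where "b j Z W =
     (let x = \<lambda>Z i. xpart (Poly_Mapping.lookup Z (i mod k));
          y = \<lambda>Z i. ypart (Poly_Mapping.lookup Z (i mod k));
          A = fst (gen_fun (step_mat \<Gamma> k j)); B = fst (snd (gen_fun (step_mat \<Gamma> k j)));
          C = snd (snd (gen_fun (step_mat \<Gamma> k j)))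
      in y Z j \<bullet> (x W (j + 1) - x W j) + y W j \<bullet> (x Z (j + 1) - x Z j)
         + 1/2 * ((A *v x Z (j + 1)) \<bullet> x W (j + 1)) + 1/2 * ((A *v x W (j + 1)) \<bullet> x Z (j + 1))
         + (B *v x Z (j + 1)) \<bullet> y W j + (B *v x W (j + 1)) \<bullet> y Z j
         + 1/2 * ((C *v y Z j) \<bullet> y W j) + 1/2 * ((C *v y W j) \<bullet> y Z j))" for j Z W
  have h: "hform \<Gamma> k Z W = (\<Sum>j<k. b j Z W)" for Z W
    unfolding hform_def action_def b_def Let_def sum_subtractf [symmetric]
    by (rule sum.cong [OF refl], subst (1 2 3) prod.collapse [symmetric],
        subst (1 2 3) prod.collapse [of "snd _", symmetric])
       (simp only: gen_value.simps lookup_add xpart_simps ypart_simps matrix_vector_right_distrib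
          inner_simps, simp add: algebra_simps)
  have "linear (b j Z)" for j Z
    by (rule linearI)
       (simp_all add: b_def Let_def lookup_add lookup_scaleR_poly_mapping inner_simps
          matrix_vector_right_distrib matrix_vector_mult_scaleR field_simps)
  then have lin: "linear (hform \<Gamma> k Z)" for Z
    unfolding h by (intro linear_compose_sum) auto
  moreover have "linear (\<lambda>Z. hform \<Gamma> k Z W)" for W
    using lin[of W] by (simp add: sym[of _ W])
  ultimately show "bilinear (hform \<Gamma> k)"
    by (simp add: bilinear_def)
qed

lemma hform_diag: "1/2 * hform \<Gamma> k Z Z = action \<Gamma> k Z"
proof -
  have "gen_value F (2 *\<^sub>R X) (2 *\<^sub>R Y) = 4 * gen_value F X Y"
    for F :: "'a quad_gen" and X Y
    by (cases F) (simp add: matrix_vector_mult_scaleR algebra_simps)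
  then have "action \<Gamma> k (2 *\<^sub>R Z) = 4 * action \<Gamma> k Z"
    unfolding action_def Let_def sum_distrib_left
    by (intro sum.cong)
       (simp_all add: lookup_scaleR_poly_mapping inner_simps algebra_simps)
  then show ?thesis
    by (simp add: hform_def scaleR_2)
qed


definition ind_on :: "'v::real_vector set \<Rightarrow> ('v \<Rightarrow> 'v \<Rightarrow> real) \<Rightarrow> nat" where
  "ind_on V h = Max {dim W |W. subspace W \<and> W \<subseteq> V \<and> (\<forall>w\<in>W. w \<noteq> 0 \<longrightarrow> h w w < 0)}"

definition coind_on :: "'v::real_vector set \<Rightarrow> ('v \<Rightarrow> 'v \<Rightarrow> real) \<Rightarrow> nat" where
  "coind_on V h = Max {dim W |W. subspace W \<and> W \<subseteq> V \<and> (\<forall>w\<in>W. w \<noteq> 0 \<longrightarrow> h w w > 0)}"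

definition mas_at :: "nat \<Rightarrow> (real \<Rightarrow> 'd::finite phase_mat) \<Rightarrow> int" where
  "mas_at k \<Gamma> = int (ind_on (config_space k) (hform \<Gamma> k)) - int (CARD('d) * k)"

definition comas_at :: "nat \<Rightarrow> (real \<Rightarrow> 'd::finite phase_mat) \<Rightarrow> int" where
  "comas_at k \<Gamma> = int (coind_on (config_space k) (hform \<Gamma> k)) - int (CARD('d) * k)"

definition mas :: "(real \<Rightarrow> 'd::finite phase_mat) \<Rightarrow> int" where
  "mas \<Gamma> = mas_at (SOME k. large_enough \<Gamma> k) \<Gamma>"

definition comas :: "(real \<Rightarrow> 'd::finite phase_mat) \<Rightarrow> int" where
  "comas \<Gamma> = comas_at (SOME k. large_enough \<Gamma> k) \<Gamma>"


definition lower_semicontinuous_map :: "'a topology \<Rightarrow> ('a \<Rightarrow> int) \<Rightarrow> bool" where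
  "lower_semicontinuous_map T f \<longleftrightarrow> (\<forall>a. openin T {x \<in> topspace T. a < f x})"

definition locally_constant_map :: "'a topology \<Rightarrow> ('a \<Rightarrow> 'b) \<Rightarrow> bool" where
  "locally_constant_map T f \<longleftrightarrow>
     (\<forall>x\<in>topspace T. \<exists>U. openin T U \<and> x \<in> U \<and> (\<forall>y\<in>U. f y = f x))"

end

theory Submission
  imports Defs
begin

text \<open>
  By Sylvester's law, \<open>ind + coind + nullity = dim\<close> for a symmetric form on a finite-dimensional
  space; both indices are lower semicontinuous in the form, hence locally constant as long as
  the nullity is. Critical points of the action are the sequences with
  \<open>Z\<^sub>j\<^sub>+\<^sub>1 = P\<^sub>j Z\<^sub>j\<close>, indices modulo \<open>k\<close>, so the nullity of \<open>h\<close> is \<open>dim (ker (\<Gamma> 1 - I))\<close> whatever the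
  subdivision. For \<open>k \<le> m\<close>, append \<open>m - k\<close> identity steps to the \<open>k\<close>-step
  subdivision, each of which raises index and coindex by \<open>d\<close>, and slide the result linearly to
  the uniform \<open>m\<close>-step subdivision: all steps on the way are at most \<open>1/k\<close> long, and the nullity
  never changes. Semicontinuity in \<open>\<Gamma>\<close> follows because one \<open>k\<close> serves all nearby paths.
\<close>

section \<open>Index, coindex and nullity\<close>

text \<open>Forms for different \<open>k\<close> live on spaces of different dimension, so
  continuity alone cannot compare them; a constant step changes the dimension without moving the
  path. Such a step adds the pairing of two free \<open>d\<close>-dimensional variables, a form of
  signature \<open>(d, d)\<close>, and this is what subtracting \<open>d k\<close> compensates. It
  is enough to exhibit \<open>d\<close> new negative and \<open>d\<close> new positive directions:
  the nullity and the total dimension leave room for no more.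

  The form sees only the values of the path at grid points. Hence the working hypothesis
  \<open>admissible\<close> is a condition on the grid, and it applies to the time changes used for
  sliding, which are not elements of \<open>symplectic_paths\<close>. Sliding needs no common
  refinement, so \<open>m\<close> need not be a multiple of \<open>k\<close>.

  A symplectic matrix has a generating function exactly if its block from x to x is invertible. This
  is an open condition on which the coefficients are rational functions of the entries; all uniform
  choices of \<open>k\<close> come from it by compactness.\<close>

definition sym_bilinear :: "('v::real_vector \<Rightarrow> 'v \<Rightarrow> real) \<Rightarrow> bool" where
  "sym_bilinear h \<longleftrightarrow> bilinear h \<and> (\<forall>x y. h x y = h y x)"

text \<open>The ambient space of sequences is infinite-dimensional, so finite dimension has to be a
  property of the set.\<close>

definition fin_dim :: "'v::real_vector set \<Rightarrow> bool" where
  "fin_dim V \<longleftrightarrow> (\<exists>S. finite S \<and> V \<subseteq> span S)"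

definition radical_on :: "'v::real_vector set \<Rightarrow> ('v \<Rightarrow> 'v \<Rightarrow> real) \<Rightarrow> 'v set" where
  "radical_on V h = {v\<in>V. \<forall>w\<in>V. h v w = 0}"

text \<open>The condition \<open>h b b \<noteq> 0\<close> lets coefficients be recovered by pairing
  with \<open>b\<close>; signs are left free, so that one family carries both indices.\<close>

definition orth_family :: "('v::real_vector \<Rightarrow> 'v \<Rightarrow> real) \<Rightarrow> 'v set \<Rightarrow> bool" where
  "orth_family h B \<longleftrightarrow> finite B \<and> pairwise (\<lambda>x y. h x y = 0) B \<and> (\<forall>b\<in>B. h b b \<noteq> 0)"

section \<open>Dimension counting in finitely spanned sets\<close>

lemma fin_dim_subset: "fin_dim V \<Longrightarrow> W \<subseteq> V \<Longrightarrow> fin_dim W"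
  unfolding fin_dim_def by blast

lemma fin_dim_independent:
  assumes "fin_dim V" "B \<subseteq> V" "independent B"
  shows "finite B" "card B \<le> dim V"
proof -
  obtain S where S: "finite S" "V \<subseteq> span S" using assms(1) by (auto simp: fin_dim_def)
  obtain C where C: "C \<subseteq> V" "independent C" "V \<subseteq> span C" "card C = dim V"
    by (metis basis_exists)
  have "finite C" using independent_span_bound[OF S(1) C(2)] C(1) S(2) by blast
  from independent_span_bound[OF this assms(3)] show "finite B" "card B \<le> dim V"
    using assms(2) C by auto
qed

lemma fin_dim_basis:
  assumes "fin_dim V"
  obtains B where "finite B" "B \<subseteq> V" "independent B" "V \<subseteq> span B" "card B = dim V"
  by (metis assms basis_exists fin_dim_independent(1))

text \<open>The elements of \<open>B\<close> are added one at a time: a dependence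
  \<open>b = x + y\<close> with \<open>x\<close> in \<open>span A\<close> and \<open>y\<close> in
  \<open>span B\<close> puts \<open>x = b - y\<close> into \<open>N \<inter> M\<close>, so
  \<open>x = 0\<close> and \<open>b\<close> would already depend on \<open>B\<close>.\<close>

lemma independent_Un:
  assumes N: "subspace N" and M: "subspace M" and NM: "N \<inter> M \<subseteq> {0}"
    and A: "A \<subseteq> N" "independent A" and B: "finite B" "B \<subseteq> M" "independent B"
  shows "independent (A \<union> B) \<and> A \<inter> B = {}"
  using B
proof (induction B)
  case empty
  then show ?case using A by simp
next
  case (insert b B)
  have ind: "independent B" "b \<notin> span B"
    using insert.prems(2) insert.hyps(2) by (auto simp: independent_insert)
  have b: "b \<notin> span (A \<union> B)"
  proof
    assume "b \<in> span (A \<union> B)"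
    then obtain x y where xy: "x \<in> span A" "y \<in> span B" "b = x + y"
      by (auto simp: span_Un)
    have "x \<in> N" using xy(1) A(1) N by (meson span_minimal subsetD)
    moreover have "y \<in> M" using xy(2) insert.prems(1) M by (meson insert_subset span_minimal subsetD)
    then have "x \<in> M" using xy(3) insert.prems(1) subspace_diff[OF M, of b y] by auto
    ultimately have "x = 0" using NM by auto
    then show False using xy ind by simp
  qed
  have "independent (A \<union> B) \<and> A \<inter> B = {}" using insert ind by auto
  then show ?case using b ind by (auto simp: independent_insert span_base)
qed

lemma dim_add_le:
  assumes "fin_dim V" "subspace N" "subspace M" "N \<subseteq> V" "M \<subseteq> V" "N \<inter> M \<subseteq> {0}"
  shows "dim N + dim M \<le> dim V"
proof -
  obtain A where A: "finite A" "A \<subseteq> N" "independent A" "card A = dim N"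
    using fin_dim_basis[OF fin_dim_subset[OF assms(1,4)]] by metis
  obtain B where B: "finite B" "B \<subseteq> M" "independent B" "card B = dim M"
    using fin_dim_basis[OF fin_dim_subset[OF assms(1,5)]] by metis
  have "independent (A \<union> B) \<and> A \<inter> B = {}"
    using independent_Un[OF assms(2,3,6) A(2,3) B(1-3)] .
  then show ?thesis
    using fin_dim_independent(2)[OF assms(1), of "A \<union> B"] A B assms(4,5)
    by (simp add: card_Un_disjoint le_sup_iff) (meson order_trans)
qed

lemma fin_dim_dim_mono: "fin_dim V \<Longrightarrow> N \<subseteq> V \<Longrightarrow> dim N \<le> dim V"
  by (metis fin_dim_basis fin_dim_subset fin_dim_independent(2) order_trans)

section \<open>Orthogonal families of a symmetric form\<close>

lemma sym_bilinearD:
  assumes "sym_bilinear h"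
  shows "linear (h x)" "linear (\<lambda>x. h x y)" "h x y = h y x"
  using assms by (auto simp: sym_bilinear_def bilinear_def)

lemma sym_bilinear_uminus: "sym_bilinear h \<Longrightarrow> sym_bilinear (\<lambda>x y. - h x y)"
  unfolding sym_bilinear_def bilinear_def by (auto intro: linear_compose_neg)

lemma sym_bilinear_simps:
  assumes "sym_bilinear h"
  shows "h (x + y) z = h x z + h y z" "h z (x + y) = h z x + h z y"
    "h (x - y) z = h x z - h y z" "h z (x - y) = h z x - h z y"
    "h (c *\<^sub>R x) z = c * h x z" "h z (c *\<^sub>R x) = c * h z x" "h 0 z = 0" "h z 0 = 0"
    "h (sum f B) z = (\<Sum>b\<in>B. h (f b) z)" "h z (sum f B) = (\<Sum>b\<in>B. h z (f b))"
  using sym_bilinearD(1)[OF assms, THEN linear_add] sym_bilinearD(2)[OF assms, THEN linear_add]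
    sym_bilinearD(1)[OF assms, THEN linear_diff] sym_bilinearD(2)[OF assms, THEN linear_diff]
    sym_bilinearD(1)[OF assms, THEN linear_scale] sym_bilinearD(2)[OF assms, THEN linear_scale]
    sym_bilinearD(1)[OF assms, THEN linear_0] sym_bilinearD(2)[OF assms, THEN linear_0]
    sym_bilinearD(1)[OF assms, THEN linear_sum] sym_bilinearD(2)[OF assms, THEN linear_sum]
  by simp_all

lemma orth_sum_right:
  assumes "sym_bilinear h" "orth_family h B" "b \<in> B"
  shows "h (\<Sum>x\<in>B. c x *\<^sub>R x) b = c b * h b b"
proof -
  have "h (\<Sum>x\<in>B. c x *\<^sub>R x) b = (\<Sum>x\<in>B. if x = b then c b * h b b else 0)"
    unfolding sym_bilinear_simps[OF assms(1)]
    by (rule sum.cong) (use assms in \<open>auto simp: orth_family_def pairwise_def\<close>)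
  then show ?thesis using assms by (simp add: orth_family_def)
qed

lemma orth_sum_diag:
  assumes "sym_bilinear h" "orth_family h B"
  shows "h (\<Sum>x\<in>B. c x *\<^sub>R x) (\<Sum>x\<in>B. c x *\<^sub>R x) = (\<Sum>x\<in>B. (c x)\<^sup>2 * h x x)"
proof -
  have "h (\<Sum>x\<in>B. c x *\<^sub>R x) (\<Sum>x\<in>B. c x *\<^sub>R x) = (\<Sum>b\<in>B. c b * h (\<Sum>x\<in>B. c x *\<^sub>R x) b)"
    by (subst sym_bilinear_simps(10)[OF assms(1)]) (simp add: sym_bilinear_simps(6)[OF assms(1)])
  then show ?thesis
    using orth_sum_right[OF assms] by (simp add: power2_eq_square mult.assoc)
qed

lemma orth_family_independent:
  assumes "sym_bilinear h" "orth_family h B"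
  shows "independent B"
proof -
  have "c b = 0" if "(\<Sum>x\<in>B. c x *\<^sub>R x) = 0" "b \<in> B" for c b
    using orth_sum_right[OF assms that(2), of c] that assms
    by (simp add: sym_bilinear_simps[OF assms(1)] orth_family_def)
  then show ?thesis
    using assms(2) by (auto simp: orth_family_def dependent_finite)
qed

section \<open>Index, coindex and Sylvester's law\<close>

lemma coind_on_eq_ind_on: "coind_on V h = ind_on V (\<lambda>x y. - h x y)"
  by (simp add: coind_on_def ind_on_def)

text \<open>Gives meaning to the \<open>Max\<close> in \<open>ind_on\<close>: the dimensions are
  bounded by \<open>dim V\<close>, and the zero subspace always qualifies.\<close>

lemma ind_on_set:
  fixes V :: "'v::real_vector set" and h :: "'v \<Rightarrow> 'v \<Rightarrow> real"
  assumes "fin_dim V" "subspace V"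
  defines "D \<equiv> {dim W |W. subspace W \<and> W \<subseteq> V \<and> (\<forall>w\<in>W. w \<noteq> 0 \<longrightarrow> h w w < 0)}"
  shows "finite D" "D \<noteq> {}"
proof -
  have "D \<subseteq> {..dim V}" using fin_dim_dim_mono[OF assms(1)] by (auto simp: D_def)
  then show "finite D" using finite_subset by blast
  have "dim {0::'v} \<in> D" unfolding D_def using subspace_0[OF assms(2)] by (force simp: subspace_def)
  then show "D \<noteq> {}" by blast
qed

lemma le_ind_on:
  assumes "fin_dim V" "subspace V" "subspace W" "W \<subseteq> V" "\<And>w. w \<in> W \<Longrightarrow> w \<noteq> 0 \<Longrightarrow> h w w < 0"
  shows "dim W \<le> ind_on V h"
  unfolding ind_on_def by (rule Max_ge[OF ind_on_set(1)]) (use assms in auto)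

lemma ind_on_witness:
  assumes "fin_dim V" "subspace V"
  obtains W where "subspace W" "W \<subseteq> V" "\<And>w. w \<in> W \<Longrightarrow> w \<noteq> 0 \<Longrightarrow> h w w < 0" "dim W = ind_on V h"
  using Max_in[OF ind_on_set[OF assms, of h]] unfolding ind_on_def by auto

lemma subspace_radical_on: "sym_bilinear h \<Longrightarrow> subspace V \<Longrightarrow> subspace (radical_on V h)"
  unfolding radical_on_def subspace_def by (auto simp: sym_bilinear_simps)

text \<open>Take an orthogonal family of maximal size. A vector of \<open>V\<close> orthogonal to it
  is isotropic, since otherwise it could be added; by polarization the orthogonal complement of the
  family in \<open>V\<close> is totally isotropic, and so it is the radical.\<close>

lemma orthogonalization:
  assumes h: "sym_bilinear h" and V: "fin_dim V" "subspace V"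
  obtains B where "orth_family h B" "B \<subseteq> V" "dim V = card B + dim (radical_on V h)"
proof -
  define Q where "Q n \<longleftrightarrow> (\<exists>B. orth_family h B \<and> B \<subseteq> V \<and> card B = n)" for n
  have "Q 0" unfolding Q_def by (rule exI[of _ "{}"]) (auto simp: orth_family_def)
  moreover have "\<forall>n. Q n \<longrightarrow> n \<le> dim V"
    using fin_dim_independent(2)[OF V(1)] orth_family_independent[OF h] by (auto simp: Q_def)
  ultimately obtain n where n: "Q n" "\<And>m. Q m \<Longrightarrow> m \<le> n"
    by (metis GreatestI_nat Greatest_le_nat)
  obtain B where B: "orth_family h B" "B \<subseteq> V" "card B = n" using n(1) by (auto simp: Q_def)
  have fB: "finite B" using B(1) by (simp add: orth_family_def)
  \<comment> \<open>Orthogonal projection onto \<open>span B\<close>; the denominators are nonzero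
    because \<open>B\<close> is an orthogonal family.\<close>
  define p where "p v = (\<Sum>b\<in>B. (h v b / h b b) *\<^sub>R b)" for v
  have pV: "p v \<in> V" for v
    unfolding p_def by (intro subspace_sum subspace_scale V) (use B in auto)
  have ps: "p v \<in> span B" for v
    unfolding p_def by (intro span_sum span_scale span_base)
  have perp: "h (v - p v) b = 0" if "b \<in> B" for v b
    using that B(1) orth_sum_right[OF h B(1) that, of "\<lambda>b. h v b / h b b"]
    by (simp add: sym_bilinear_simps[OF h] p_def[symmetric] orth_family_def)
  have iso: "h v v = 0" if "v \<in> V" "\<And>b. b \<in> B \<Longrightarrow> h v b = 0" for v
  proof (rule ccontr)
    assume nz: "h v v \<noteq> 0"
    then have "v \<notin> B" using that(2) by auto
    moreover have "orth_family h (insert v B)"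
      using B(1) nz that(2) sym_bilinearD(3)[OF h]
      by (auto simp: orth_family_def pairwise_insert)
    ultimately have "Q (Suc n)"
      unfolding Q_def using B fB that(1) by (intro exI[of _ "insert v B"]) auto
    then show False using n(2) by fastforce
  qed
  \<comment> \<open>Polarization: \<open>v\<close>, \<open>w\<close> and \<open>v + w\<close> are
    all isotropic by \<open>iso\<close>.\<close>
  have iso2: "h v w = 0" if "v \<in> V" "w \<in> V" "\<And>b. b \<in> B \<Longrightarrow> h v b = 0" "\<And>b. b \<in> B \<Longrightarrow> h w b = 0" for v w
    using iso[of "v + w"] iso[of v] iso[of w] that subspace_add[OF V(2)] sym_bilinearD(3)[OF h, of v w]
    by (simp add: sym_bilinear_simps[OF h])
  have rad: "v - p v \<in> radical_on V h" if "v \<in> V" for v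
  proof -
    have "h (v - p v) w = 0" if w: "w \<in> V" for w
    proof -
      have "h (v - p v) (w - p w) = 0"
        by (rule iso2) (use \<open>v \<in> V\<close> w pV subspace_diff[OF V(2)] perp in auto)
      moreover have "h (v - p v) (p w) = 0"
        unfolding p_def[of w] by (simp add: sym_bilinear_simps(6,10)[OF h] perp)
      ultimately show ?thesis by (simp add: sym_bilinear_simps(4)[OF h])
    qed
    then show ?thesis using that pV subspace_diff[OF V(2)] by (auto simp: radical_on_def)
  qed
  have triv: "span B \<inter> radical_on V h \<subseteq> {0}"
  proof
    fix v assume v: "v \<in> span B \<inter> radical_on V h"
    then obtain c where c: "v = (\<Sum>b\<in>B. c b *\<^sub>R b)" using span_finite[OF fB] by auto
    have "c b = 0" if "b \<in> B" for b
      using orth_sum_right[OF h B(1) that, of c] v that B unfolding c[symmetric]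
      by (auto simp: radical_on_def orth_family_def)
    then show "v \<in> {0}" by (simp add: c)
  qed
  have rV: "radical_on V h \<subseteq> V" by (auto simp: radical_on_def)
  obtain C where C: "finite C" "C \<subseteq> radical_on V h" "independent C" "radical_on V h \<subseteq> span C"
      "card C = dim (radical_on V h)"
    using fin_dim_basis[OF fin_dim_subset[OF V(1) rV]] by metis
  have "independent (B \<union> C) \<and> B \<inter> C = {}"
    using independent_Un[OF subspace_span subspace_radical_on[OF h V(2)] triv span_superset
        orth_family_independent[OF h B(1)] C(1-3)] .
  moreover have "V \<subseteq> span (B \<union> C)"
  proof
    fix v assume "v \<in> V"
    then have "p v + (v - p v) \<in> span (B \<union> C)"
      using ps rad C(4) by (intro span_add) (auto intro: span_mono[THEN subsetD])
    then show "v \<in> span (B \<union> C)" by simp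
  qed
  ultimately have "card (B \<union> C) = dim V"
    using B(2) C(2) rV by (intro basis_card_eq_dim) auto
  then show thesis
    using that[OF B(1,2)] C fB \<open>independent (B \<union> C) \<and> B \<inter> C = {}\<close> by (simp add: card_Un_disjoint)
qed

lemma nonzero_coefficient:
  fixes c :: "'v::real_vector \<Rightarrow> real"
  assumes "(\<Sum>b\<in>B. c b *\<^sub>R b) \<noteq> 0"
  obtains b where "b \<in> B" "c b \<noteq> 0"
proof (rule ccontr)
  assume "\<not> thesis"
  then have "\<forall>b\<in>B. c b *\<^sub>R b = 0" using that by auto
  then have "(\<Sum>b\<in>B. c b *\<^sub>R b) = 0" by (rule sum.neutral)
  then show False using assms by contradiction
qed

lemma span_orth_negative:
  assumes h: "sym_bilinear h" and B: "orth_family h B" "\<And>b. b \<in> B \<Longrightarrow> h b b < 0"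
    and v: "v \<in> span B" "v \<noteq> 0"
  shows "h v v < 0"
proof -
  have fB: "finite B" using B by (simp add: orth_family_def)
  obtain c where c: "v = (\<Sum>b\<in>B. c b *\<^sub>R b)" using v span_finite[OF fB] by auto
  obtain b where b: "b \<in> B" "c b \<noteq> 0" using v(2) unfolding c by (rule nonzero_coefficient)
  have "(\<Sum>x\<in>B. (c x)\<^sup>2 * h x x) < (\<Sum>x\<in>B. 0)"
    by (rule sum_strict_mono_ex1[OF fB]) (use B(2) b in \<open>auto simp: mult_le_0_iff mult_less_0_iff intro!: bexI[of _ b] less_imp_le\<close>)
  then show ?thesis unfolding c orth_sum_diag[OF h B(1)] by simp
qed

lemma orth_subset: "orth_family h B \<Longrightarrow> C \<subseteq> B \<Longrightarrow> orth_family h C"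
  by (auto simp: orth_family_def pairwise_def intro: finite_subset)

lemma orth_family_uminus: "orth_family h B \<Longrightarrow> orth_family (\<lambda>x y. - h x y) B"
  by (simp add: orth_family_def pairwise_def)

text \<open>The negative part of \<open>B\<close> spans a negative definite subspace, which gives
  one inequality. For the other, the positive part and the radical span a subspace on which
  \<open>h\<close> is nonnegative; a negative definite subspace meets it only in 0, so the two
  dimensions add up to at most \<open>dim V\<close>.\<close>

lemma ind_on_eq_card:
  assumes h: "sym_bilinear h" and V: "fin_dim V" "subspace V"
    and B: "orth_family h B" "B \<subseteq> V" "dim V = card B + dim (radical_on V h)"
  shows "ind_on V h = card {b\<in>B. h b b < 0}"
proof (rule antisym)
  have fB: "finite B" using B(1) by (simp add: orth_family_def)
  let ?N = "{b\<in>B. h b b < 0}" and ?P = "{b\<in>B. h b b > 0}"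
  have N: "orth_family h ?N" and P: "orth_family h ?P" using orth_subset[OF B(1)] by auto
  have BNP: "card B = card ?N + card ?P"
    using B(1) fB by (subst card_Un_disjoint[symmetric]) (auto simp: orth_family_def intro!: arg_cong[where f = card])
  have sub: "span C \<subseteq> V" if "C \<subseteq> B" for C
    using that B(2) V(2) by (intro span_minimal) auto
  have "dim (span ?N) \<le> ind_on V h"
    using span_orth_negative[OF h N] sub[of ?N] by (intro le_ind_on V subspace_span) auto
  then show "card ?N \<le> ind_on V h"
    by (simp add: dim_eq_card_independent[OF orth_family_independent[OF h N]])
  obtain W where W: "subspace W" "W \<subseteq> V" "\<And>w. w \<in> W \<Longrightarrow> w \<noteq> 0 \<Longrightarrow> h w w < 0" "dim W = ind_on V h"
    using ind_on_witness[OF V, of h] by metis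
  let ?R = "radical_on V h"
  have R: "subspace ?R" "?R \<subseteq> V" using subspace_radical_on[OF h V(2)] by (auto simp: radical_on_def)
  define M where "M = {x + y |x y. x \<in> span ?P \<and> y \<in> ?R}"
  have M: "subspace M" unfolding M_def by (intro subspace_sums subspace_span R)
  have MV: "M \<subseteq> V" 
  proof
    fix m assume "m \<in> M"
    then obtain x y where xy: "m = x + y" "x \<in> span ?P" "y \<in> ?R" by (auto simp: M_def)
    have "x \<in> V" "y \<in> V" using xy R(2) sub[of ?P] by auto
    then show "m \<in> V" using xy(1) subspace_add[OF V(2)] by simp
  qed
  have pos: "h x x > 0" if "x \<in> span ?P" "x \<noteq> 0" for x
  proof -
    have "orth_family (\<lambda>x y. - h x y) ?P" using P by (rule orth_family_uminus)
    then show ?thesis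
      using span_orth_negative[OF sym_bilinear_uminus[OF h], of ?P x] that by simp
  qed
  have "card ?P + dim ?R \<le> dim M"
  proof -
    have "dim (span ?P) + dim ?R \<le> dim M"
    proof (rule dim_add_le)
      show "span ?P \<subseteq> M"
      proof
        fix x assume "x \<in> span ?P"
        then show "x \<in> M" unfolding M_def using subspace_0[OF R(1)]
          by (intro CollectI exI[of _ x] exI[of _ 0]) simp
      qed
      show "?R \<subseteq> M"
      proof
        fix y assume "y \<in> ?R"
        then show "y \<in> M" unfolding M_def using span_zero[of ?P]
          by (intro CollectI exI[of _ 0] exI[of _ y]) simp
      qed
      show "span ?P \<inter> ?R \<subseteq> {0}"
      proof
        fix x assume x: "x \<in> span ?P \<inter> ?R"
        then have "h x x = 0" by (simp add: radical_on_def)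
        then show "x \<in> {0}" using pos[of x] x by force
      qed
    qed (use R fin_dim_subset[OF V(1) MV] in auto)
    then show ?thesis by (simp add: dim_eq_card_independent[OF orth_family_independent[OF h P]])
  qed
  moreover have "W \<inter> M \<subseteq> {0}"
  proof
    fix w assume w: "w \<in> W \<inter> M"
    then obtain x y where xy: "w = x + y" "x \<in> span ?P" "y \<in> ?R" by (auto simp: M_def)
    have "x \<in> V" using xy sub[of ?P] by auto
    then have "h w w = h x x"
      using xy(3) R(2) sym_bilinearD(3)[OF h, of x y] unfolding xy(1)
      by (auto simp: sym_bilinear_simps[OF h] radical_on_def)
    also have "\<dots> \<ge> 0" using pos[OF xy(2)] by (cases "x = 0") (auto simp: sym_bilinear_simps[OF h])
    finally show "w \<in> {0}" using W(3)[of w] w by force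
  qed
  then have "dim W + dim M \<le> dim V" by (intro dim_add_le V W M MV)
  ultimately show "ind_on V h \<le> card ?N" using W(4) B(3) BNP by simp
qed

lemma sylvester_law:
  assumes h: "sym_bilinear h" and V: "fin_dim V" "subspace V"
  obtains B where "orth_family h B" "B \<subseteq> V" "ind_on V h = card {b\<in>B. h b b < 0}"
    "dim V = ind_on V h + coind_on V h + dim (radical_on V h)"
proof -
  obtain B where B: "orth_family h B" "B \<subseteq> V" "dim V = card B + dim (radical_on V h)"
    by (rule orthogonalization[OF assms])
  have fB: "finite B" using B(1) by (simp add: orth_family_def)
  have rad: "radical_on V (\<lambda>x y. - h x y) = radical_on V h" by (simp add: radical_on_def)
  have ind: "ind_on V h = card {b\<in>B. h b b < 0}" by (rule ind_on_eq_card[OF assms B])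
  have "coind_on V h = card {b\<in>B. - h b b < 0}" unfolding coind_on_eq_ind_on
    by (rule ind_on_eq_card[OF sym_bilinear_uminus[OF h] V])
       (use B rad orth_family_uminus[OF B(1)] in auto)
  moreover have "card B = card {b\<in>B. h b b < 0} + card {b\<in>B. - h b b < 0}"
    using B(1) fB by (subst card_Un_disjoint[symmetric]) (auto simp: orth_family_def intro!: arg_cong[where f = card])
  ultimately show thesis using that[OF B(1,2) ind] ind B(3) by simp
qed

corollary ind_coind_nullity:
  assumes "sym_bilinear h" "fin_dim V" "subspace V"
  shows "dim V = ind_on V h + coind_on V h + dim (radical_on V h)"
  by (rule sylvester_law[OF assms])

lemma ind_on_orth_family:
  assumes "sym_bilinear h" "fin_dim V" "subspace V"
  obtains B where "orth_family h B" "B \<subseteq> V" "\<And>b. b \<in> B \<Longrightarrow> h b b < 0" "card B = ind_on V h"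
proof -
  obtain B where B: "orth_family h B" "B \<subseteq> V" "ind_on V h = card {b\<in>B. h b b < 0}"
    by (rule sylvester_law[OF assms])
  show thesis
  proof (rule that)
    show "orth_family h {b\<in>B. h b b < 0}" by (rule orth_subset[OF B(1)]) blast
  qed (use B in auto)
qed

text \<open>Distinct indices automatically give distinct vectors: a repeated value would be
  orthogonal to itself and negative.\<close>

lemma card_le_ind_on:
  assumes h: "sym_bilinear h" and V: "fin_dim V" "subspace V" and I: "finite I"
    and b: "\<And>i. i \<in> I \<Longrightarrow> b i \<in> V" "\<And>i. i \<in> I \<Longrightarrow> h (b i) (b i) < 0"
      "\<And>i j. i \<in> I \<Longrightarrow> j \<in> I \<Longrightarrow> i \<noteq> j \<Longrightarrow> h (b i) (b j) = 0"
  shows "card I \<le> ind_on V h"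
proof -
  have inj: "inj_on b I" using b(2,3) by (metis inj_onI less_irrefl)
  have B: "orth_family h (b ` I)"
    unfolding orth_family_def pairwise_def using I b(2,3) by (auto simp: less_imp_neq)
  have "dim (span (b ` I)) \<le> ind_on V h"
    using span_orth_negative[OF h B] b by (intro le_ind_on V subspace_span span_minimal) auto
  then show ?thesis
    by (simp add: dim_eq_card_independent[OF orth_family_independent[OF h B]] card_image[OF inj])
qed

section \<open>Semicontinuity of the indices\<close>

lemma perturbed_negative:
  assumes h: "sym_bilinear h" "orth_family h B" and g: "sym_bilinear g"
    and m: "m > 0" "\<And>b. b \<in> B \<Longrightarrow> h b b \<le> - m"
    and close: "\<And>b b'. b \<in> B \<Longrightarrow> b' \<in> B \<Longrightarrow> \<bar>g b b' - h b b'\<bar> \<le> m / (1 + real (card B))"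
    and c: "b0 \<in> B" "c b0 \<noteq> 0"
  shows "g (\<Sum>b\<in>B. c b *\<^sub>R b) (\<Sum>b\<in>B. c b *\<^sub>R b) < 0"
proof -
  have fB: "finite B" using h by (simp add: orth_family_def)
  \<comment> \<open>The perturbation costs at most \<open>card B * e * s\<close>, while the
    unperturbed value is at most \<open>- m * s\<close>. This \<open>e\<close> solves
    \<open>m - card B * e = e\<close>, which leaves \<open>- e * s\<close>.\<close>
  define e where "e = m / (1 + real (card B))"
  define s where "s = (\<Sum>b\<in>B. (c b)\<^sup>2)"
  define v where "v = (\<Sum>b\<in>B. c b *\<^sub>R b)"
  have s: "s > 0" unfolding s_def using c fB by (intro sum_pos2[of _ b0]) auto
  have expand: "f v v = (\<Sum>b\<in>B. \<Sum>b'\<in>B. c b * c b' * f b b')" if "sym_bilinear f" for f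
  proof -
    have "f b v = (\<Sum>b'\<in>B. c b' * f b b')" for b
      by (simp add: v_def sym_bilinear_simps(6,10)[OF that])
    then have "(\<Sum>b\<in>B. c b * f b v) = (\<Sum>b\<in>B. \<Sum>b'\<in>B. c b * c b' * f b b')"
      by (simp add: sum_distrib_left mult.assoc)
    moreover have "f v v = (\<Sum>b\<in>B. c b * f b v)"
      by (subst v_def) (simp add: sym_bilinear_simps(5,9)[OF that])
    ultimately show ?thesis by simp
  qed
  have "g v v - h v v = (\<Sum>b\<in>B. \<Sum>b'\<in>B. c b * c b' * (g b b' - h b b'))"
    by (simp add: expand[OF g] expand[OF h(1)] sum_subtractf right_diff_distrib)
  also have "\<dots> \<le> (\<Sum>b\<in>B. \<Sum>b'\<in>B. ((c b)\<^sup>2 + (c b')\<^sup>2) / 2 * e)"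
  proof (intro sum_mono)
    fix b b' assume "b \<in> B" "b' \<in> B"
    have "c b * c b' * (g b b' - h b b') \<le> \<bar>c b * c b'\<bar> * \<bar>g b b' - h b b'\<bar>"
      by (metis abs_ge_self abs_mult)
    also have "\<dots> \<le> ((c b)\<^sup>2 + (c b')\<^sup>2) / 2 * e"
    proof (intro mult_mono)
      have "0 \<le> (\<bar>c b\<bar> - \<bar>c b'\<bar>)\<^sup>2" by simp
      then show "\<bar>c b * c b'\<bar> \<le> ((c b)\<^sup>2 + (c b')\<^sup>2) / 2"
        by (simp add: power2_diff abs_mult)
    qed (use close \<open>b \<in> B\<close> \<open>b' \<in> B\<close> in \<open>auto simp: e_def\<close>)
    finally show "c b * c b' * (g b b' - h b b') \<le> ((c b)\<^sup>2 + (c b')\<^sup>2) / 2 * e" .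
  qed
  also have "\<dots> = real (card B) * s * e"
    by (simp add: sum.distrib add_divide_distrib distrib_right sum_distrib_left[symmetric] sum_distrib_right[symmetric]
        sum_divide_distrib[symmetric] s_def)
  finally have 1: "g v v \<le> h v v + real (card B) * e * s" by (simp add: algebra_simps)
  have "h v v \<le> (\<Sum>x\<in>B. (c x)\<^sup>2 * (- m))"
    unfolding v_def orth_sum_diag[OF h] by (intro sum_mono mult_left_mono m(2)) auto
  also have "\<dots> = - m * s" by (simp add: s_def sum_distrib_left mult.commute sum_negf)
  finally have "g v v \<le> - ((m - real (card B) * e) * s)" using 1 by (simp add: algebra_simps)
  moreover have "m - real (card B) * e = e" by (simp add: e_def field_simps)
  moreover have "e * s > 0" using m(1) s by (simp add: e_def)
  ultimately show ?thesis unfolding v_def by simp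
qed

text \<open>Only finitely many values matter, those on a negative orthogonal family of maximal size.
  Once they are close, the span of the same family is negative definite for the perturbed
  form.\<close>

lemma ind_on_lower_semicontinuous:
  fixes h :: "'v::real_vector \<Rightarrow> 'v \<Rightarrow> real" and g :: "'a \<Rightarrow> 'v \<Rightarrow> 'v \<Rightarrow> real"
  assumes h: "sym_bilinear h" and g: "\<And>x. sym_bilinear (g x)" and V: "fin_dim V" "subspace V"
    and lim: "\<And>v w. v \<in> V \<Longrightarrow> w \<in> V \<Longrightarrow> ((\<lambda>x. g x v w) \<longlongrightarrow> h v w) F"
  shows "eventually (\<lambda>x. ind_on V h \<le> ind_on V (g x)) F"
proof -
  obtain B where B: "orth_family h B" "B \<subseteq> V" "\<And>b. b \<in> B \<Longrightarrow> h b b < 0" "card B = ind_on V h"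
    using ind_on_orth_family[OF h V] by blast
  have fB: "finite B" using B by (simp add: orth_family_def)
  \<comment> \<open>The inserted 1 provides a positive bound also for an empty family.\<close>
  define m where "m = Min (insert 1 ((\<lambda>b. - h b b) ` B))"
  have m: "m > 0" "\<And>b. b \<in> B \<Longrightarrow> h b b \<le> - m"
  proof -
    show "m > 0" unfolding m_def using fB B(3) by (subst Min_gr_iff) auto
    fix b assume "b \<in> B"
    then have "m \<le> - h b b" unfolding m_def using fB by (intro Min_le) auto
    then show "h b b \<le> - m" by simp
  qed
  define e where "e = m / (1 + real (card B))"
  have e: "e > 0" using m by (simp add: e_def)
  have "eventually (\<lambda>x. \<forall>b\<in>B. \<forall>b'\<in>B. \<bar>g x b b' - h b b'\<bar> < e) F"
    using fB e tendstoD[OF lim] B(2)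
    by (intro eventually_ball_finite ballI) (auto simp: dist_real_def subset_iff)
  then show ?thesis
  proof eventually_elim
    case (elim x)
    have neg: "g x (\<Sum>b\<in>B. c b *\<^sub>R b) (\<Sum>b\<in>B. c b *\<^sub>R b) < 0" if "b0 \<in> B" "c b0 \<noteq> 0" for c b0
      by (rule perturbed_negative[where h = h and m = m])
         (use h g m B that elim in \<open>auto simp: e_def intro: less_imp_le\<close>)
    have "dim (span B) \<le> ind_on V (g x)"
    proof (intro le_ind_on V subspace_span span_minimal B)
      fix w assume w: "w \<in> span B" "w \<noteq> 0"
      obtain c where c: "w = (\<Sum>b\<in>B. c b *\<^sub>R b)" using w span_finite[OF fB] by auto
      obtain b where "b \<in> B" "c b \<noteq> 0" using w(2) unfolding c by (rule nonzero_coefficient)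
      then show "g x w w < 0" unfolding c by (rule neg)
    qed
    then show ?case
      by (simp add: dim_eq_card_independent[OF orth_family_independent[OF h B(1)]] B(4))
  qed
qed

lemma coind_on_lower_semicontinuous:
  assumes "sym_bilinear h" "\<And>x. sym_bilinear (g x)" "fin_dim V" "subspace V"
    and "\<And>v w. v \<in> V \<Longrightarrow> w \<in> V \<Longrightarrow> ((\<lambda>x. g x v w) \<longlongrightarrow> h v w) F"
  shows "eventually (\<lambda>x. coind_on V h \<le> coind_on V (g x)) F"
  unfolding coind_on_eq_ind_on
  by (intro ind_on_lower_semicontinuous sym_bilinear_uminus assms tendsto_minus)

text \<open>Constant nullity fixes the sum of the two indices; as neither of them drops, neither can
  rise.\<close>

lemma index_locally_constant:
  assumes h: "sym_bilinear h" and g: "\<And>x. sym_bilinear (g x)" and V: "fin_dim V" "subspace V"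
    and lim: "\<And>v w. v \<in> V \<Longrightarrow> w \<in> V \<Longrightarrow> ((\<lambda>x. g x v w) \<longlongrightarrow> h v w) F"
    and rad: "eventually (\<lambda>x. dim (radical_on V (g x)) = dim (radical_on V h)) F"
  shows "eventually (\<lambda>x. ind_on V (g x) = ind_on V h \<and> coind_on V (g x) = coind_on V h) F"
proof -
  have 1: "eventually (\<lambda>x. ind_on V h \<le> ind_on V (g x)) F"
    and 2: "eventually (\<lambda>x. coind_on V h \<le> coind_on V (g x)) F"
    by (rule ind_on_lower_semicontinuous[OF h g V lim] coind_on_lower_semicontinuous[OF h g V lim],
        assumption+)+
  show ?thesis
    using rad 1 2
  proof eventually_elim
    case (elim x)
    then show ?case
      using ind_coind_nullity[OF h V] ind_coind_nullity[OF g V, of x] by simp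
  qed
qed

section \<open>Symplectic matrices and generating functions\<close>

definition phase_join :: "real ^ 'd \<Rightarrow> real ^ 'd \<Rightarrow> 'd::finite phase" where
  "phase_join x y = (\<chi> i. case i of Inl a \<Rightarrow> x $ a | Inr b \<Rightarrow> y $ b)"

lemma phase_join_parts [simp]: "xpart (phase_join x y) = x" "ypart (phase_join x y) = y"
  by (simp_all add: phase_join_def xpart_def ypart_def vec_eq_iff)

lemma phase_eq_iff: "z = w \<longleftrightarrow> xpart z = xpart w \<and> ypart z = ypart w"
  unfolding xpart_def ypart_def vec_eq_iff by simp (metis sum.exhaust)

lemma parts_diff [simp]: "xpart (z - w) = xpart z - xpart w" "ypart (z - w) = ypart z - ypart w"
  by (simp_all add: xpart_def ypart_def vec_eq_iff)

lemma parts_0 [simp]: "xpart 0 = 0" "ypart 0 = 0"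
  by (simp_all add: xpart_def ypart_def vec_eq_iff)

definition blk :: "('d \<Rightarrow> 'd + 'd) \<Rightarrow> ('d \<Rightarrow> 'd + 'd) \<Rightarrow> 'd::finite phase_mat \<Rightarrow> real ^ 'd ^ 'd" where
  "blk r c P = (\<chi> i j. P $ r i $ c j)"

lemma sum_UNIV_sum:
  "(\<Sum>i\<in>(UNIV :: ('a::finite + 'b::finite) set). f i) = (\<Sum>a\<in>UNIV. f (Inl a)) + (\<Sum>b\<in>UNIV. f (Inr b))"
  by (simp add: UNIV_Plus_UNIV[symmetric] sum.Plus del: UNIV_Plus_UNIV)

lemma parts_mult:
  "xpart (P *v z) = blk Inl Inl P *v xpart z + blk Inl Inr P *v ypart z"
  "ypart (P *v z) = blk Inr Inl P *v xpart z + blk Inr Inr P *v ypart z"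
  by (simp_all add: xpart_def ypart_def blk_def matrix_vector_mult_def vec_eq_iff sum_UNIV_sum)

text \<open>With blocks \<open>a, b, c, d\<close> of \<open>P\<close>, solving
  \<open>X' = a X + b Y\<close> for \<open>X\<close> expresses the rest through the mixed
  coordinates \<open>(X', Y)\<close>: \<open>X = a^-1 X' - a^-1 b Y\<close> and
  \<open>Y' = c a^-1 X' + (d - c a^-1 b) Y\<close>. Comparison with the generating relations gives
  \<open>A = c a^-1\<close>, \<open>B = a^-1 - 1\<close>, \<open>C = - a^-1 b\<close>.\<close>

definition gen_of :: "'d::finite phase_mat \<Rightarrow> 'd quad_gen" where
  "gen_of P = (let a' = matrix_inv (blk Inl Inl P)
     in (blk Inr Inl P ** a', a' - mat 1, - (a' ** blk Inl Inr P)))"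

lemma SpD: "P \<in> Sp \<Longrightarrow> omega (P *v v) (P *v w) = omega v w"
  by (simp add: Sp_def)

lemma matrix_inv_mult:
  fixes A :: "real ^ 'n ^ 'n"
  assumes "det A \<noteq> 0"
  shows "matrix_inv A ** A = mat 1" "A ** matrix_inv A = mat 1"
proof -
  have "invertible A" using assms by (simp add: invertible_det_nz)
  then have "\<exists>B. A ** B = mat 1 \<and> B ** A = mat 1" by (simp add: invertible_def)
  from someI_ex[OF this] show "matrix_inv A ** A = mat 1" "A ** matrix_inv A = mat 1"
    by (simp_all add: matrix_inv_def)
qed

lemma matrix_inv_vector:
  fixes A :: "real ^ 'n ^ 'n"
  assumes "det A \<noteq> 0"
  shows "matrix_inv A *v (A *v x) = x" "A *v (matrix_inv A *v x) = x"
  using matrix_inv_mult[OF assms] by (simp_all add: matrix_vector_mul_assoc)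

lemma matrix_vector_uminus:
  fixes A :: "real ^ 'n ^ 'm"
  shows "A *v (- x) = - (A *v x)" "(- A) *v x = - (A *v x)"
  by (simp_all add: matrix_vector_mult_def vec_eq_iff sum_negf)

lemma symmetric_matrixI:
  fixes M N :: "real ^ 'n ^ 'n"
  assumes "\<And>x y. (M *v x) \<bullet> y = x \<bullet> (N *v y)"
  shows "transpose M = N"
proof -
  have "(transpose M *v y) \<bullet> x = (N *v y) \<bullet> x" for x y
    by (metis assms dot_lmul_matrix inner_commute transpose_matrix_vector)
  then have "transpose M *v y = N *v y" for y
    by (metis vector_eq_rdot)
  then show ?thesis by (simp add: matrix_eq)
qed

text \<open>Solving for \<open>X\<close> already determines the coefficients; symplecticity supplies
  the symmetry of \<open>A\<close> and \<open>C\<close>, and it identifies the remaining coefficient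
  \<open>d - c a^-1 b\<close> with the transpose of \<open>a^-1\<close>.\<close>

lemma generates_gen_of:
  fixes P :: "'d::finite phase_mat"
  assumes P: "P \<in> Sp" and nz: "det (blk Inl Inl P) \<noteq> 0"
  shows "generates (gen_of P) P"
proof -
  define a b c d where "a = blk Inl Inl P" "b = blk Inl Inr P" "c = blk Inr Inl P" "d = blk Inr Inr P"
  define a' where "a' = matrix_inv a"
  have inv: "a' *v (a *v x) = x" "a *v (a' *v x) = x" for x
    using matrix_inv_vector[of a] nz by (simp_all add: a'_def a_b_c_d_def)
  have parts: "xpart (P *v z) = a *v xpart z + b *v ypart z"
    "ypart (P *v z) = c *v xpart z + d *v ypart z" for z
    by (simp_all add: parts_mult a_b_c_d_def)
  \<comment> \<open>\<open>p x\<close> and \<open>q y\<close> are the initial points with mixed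
    coordinates \<open>(X', Y)\<close> equal to \<open>(x, 0)\<close> and \<open>(0, y)\<close>.
    Invariance of \<open>omega\<close> on two points \<open>p\<close>, on two points
    \<open>q\<close> and on a mixed pair gives the three matrix identities below.\<close>
  define p where "p x = phase_join (a' *v x) 0" for x
  define q where "q y = phase_join (- (a' *v (b *v y))) y" for y
  have Pp: "xpart (P *v p x) = x" "ypart (P *v p x) = c *v (a' *v x)" for x
    by (simp_all add: parts p_def inv)
  have Pq: "xpart (P *v q y) = 0" "ypart (P *v q y) = d *v y - c *v (a' *v (b *v y))" for y
    by (simp_all add: parts q_def inv matrix_vector_uminus)
  have A: "transpose (c ** a') = c ** a'"
  proof (rule symmetric_matrixI)
    fix x y show "((c ** a') *v x) \<bullet> y = x \<bullet> ((c ** a') *v y)"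
      using SpD[OF P, of "p x" "p y"]
      by (simp add: omega_def Pp) (simp add: p_def matrix_vector_mul_assoc)
  qed
  have C: "transpose (- (a' ** b)) = - (a' ** b)"
  proof (rule symmetric_matrixI)
    fix x y show "((- (a' ** b)) *v x) \<bullet> y = x \<bullet> ((- (a' ** b)) *v y)"
      using SpD[OF P, of "q x" "q y"]
      by (simp add: omega_def Pq) (simp add: q_def matrix_vector_mul_assoc[symmetric] matrix_vector_uminus)
  qed
  have B: "transpose a' = d - c ** (a' ** b)"
  proof (rule symmetric_matrixI)
    fix x y show "(a' *v x) \<bullet> y = x \<bullet> ((d - c ** (a' ** b)) *v y)"
      using SpD[OF P, of "p x" "q y"]
      by (simp add: omega_def Pp Pq) (simp add: p_def q_def matrix_vector_mul_assoc[symmetric] matrix_vector_mult_diff_rdistrib)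
  qed
  have B': "transpose (a' - mat 1) *v y = d *v y - c *v (a' *v (b *v y)) - y" for y
  proof -
    have "transpose (a' - mat 1) = transpose a' - mat 1"
      by (simp add: transpose_def mat_def vec_eq_iff)
    then show ?thesis by (simp add: B matrix_vector_mult_diff_rdistrib matrix_vector_mul_assoc[symmetric])
  qed
  have "P *v z = z' \<longleftrightarrow>
      xpart z' - xpart z = - ((a' - mat 1) *v xpart z') - (- (a' ** b)) *v ypart z \<and>
      ypart z' - ypart z = (c ** a') *v xpart z' + transpose (a' - mat 1) *v ypart z" for z z'
  proof -
    have "a *v xpart z + b *v ypart z = xpart z' \<longleftrightarrow> xpart z + a' *v (b *v ypart z) = a' *v xpart z'"
      by (metis inv matrix_vector_right_distrib)
    moreover have "c *v xpart z + d *v ypart z = ypart z' \<longleftrightarrow>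
        ypart z' - ypart z = (c ** a') *v xpart z' + transpose (a' - mat 1) *v ypart z"
      if "xpart z + a' *v (b *v ypart z) = a' *v xpart z'"
      unfolding B' matrix_vector_mul_assoc[symmetric] that[symmetric] matrix_vector_right_distrib
      by (auto simp: algebra_simps)
    ultimately show ?thesis
      unfolding phase_eq_iff parts
      by (auto simp: matrix_vector_mult_diff_rdistrib matrix_vector_uminus matrix_vector_mul_assoc algebra_simps)
  qed
  then show ?thesis
    using A C unfolding gen_of_def Let_def a_b_c_d_def[symmetric] a'_def[symmetric] by simp
qed

text \<open>A point \<open>(x, 0)\<close> with \<open>x\<close> in the kernel of the block has
  \<open>X' = 0\<close> and \<open>Y = 0\<close>, and the first generating relation then forces
  \<open>x = 0\<close>.\<close>

lemma generates_imp_det: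
  fixes P :: "'d::finite phase_mat"
  assumes "generates F P"
  shows "det (blk Inl Inl P) \<noteq> 0"
proof -
  obtain A B C where F: "F = (A, B, C)" by (cases F)
  then have gen: "xpart (P *v z) - xpart z = - (B *v xpart (P *v z)) - C *v ypart z" for z
    using assms by (metis generates.simps)
  have "x = 0" if "blk Inl Inl P *v x = 0" for x
    using gen[of "phase_join x 0"] that by (simp add: parts_mult)
  then show ?thesis
    by (metis invertible_det_nz invertible_left_inverse matrix_left_invertible_ker)
qed

lemma generated_iff:
  "P \<in> Sp \<Longrightarrow> (\<exists>F. generates F P) \<longleftrightarrow> det (blk Inl Inl P) \<noteq> 0"
  using generates_gen_of generates_imp_det by blast

lemma gen_fun_eq_gen_of: "P \<in> Sp \<Longrightarrow> det (blk Inl Inl P) \<noteq> 0 \<Longrightarrow> gen_fun P = gen_of P"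
  by (intro gen_fun_eq generates_gen_of)

lemma Sp_mat_1 [simp]: "mat 1 \<in> Sp"
  by (simp add: Sp_def)

lemma Sp_mult: "P \<in> Sp \<Longrightarrow> Q \<in> Sp \<Longrightarrow> P ** Q \<in> Sp"
  by (simp add: Sp_def matrix_vector_mul_assoc[symmetric])

lemma Sp_det:
  fixes P :: "'d::finite phase_mat"
  assumes "P \<in> Sp" shows "det P \<noteq> 0"
proof -
  have "v = 0" if "P *v v = 0" for v
  proof -
    have "omega v w = 0" for w
      using SpD[OF assms, of v w] that by (simp add: omega_def)
    \<comment> \<open>Pairing with this rotated copy of \<open>v\<close> produces the squared norm
      of \<open>v\<close>.\<close>
    from this[of "phase_join (- ypart v) (xpart v)"]
    have "xpart v \<bullet> xpart v + ypart v \<bullet> ypart v = 0" by (simp add: omega_def)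
    then have "xpart v = 0 \<and> ypart v = 0"
      by (metis add_nonneg_eq_0_iff inner_eq_zero_iff inner_ge_zero)
    then show "v = 0" by (simp add: phase_eq_iff)
  qed
  then show ?thesis
    by (metis invertible_det_nz invertible_left_inverse matrix_left_invertible_ker)
qed

lemma Sp_matrix_inv:
  fixes P :: "'d::finite phase_mat"
  assumes "P \<in> Sp" shows "matrix_inv P \<in> Sp"
  unfolding Sp_def
  using SpD[OF assms, of "matrix_inv P *v _" "matrix_inv P *v _"] matrix_inv_vector(2)[OF Sp_det[OF assms]]
  by simp

section \<open>Continuity of inverses and of generating functions\<close>

lemma tendsto_det [tendsto_intros]:
  fixes f :: "'a \<Rightarrow> real ^ 'n ^ 'n"
  assumes "(f \<longlongrightarrow> A) F"
  shows "((\<lambda>x. det (f x)) \<longlongrightarrow> det A) F"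
  unfolding det_def by (intro tendsto_intros assms)

lemma tendsto_matrix_mult [tendsto_intros]:
  fixes f g :: "'a \<Rightarrow> real ^ 'n::finite ^ 'n"
  assumes "(f \<longlongrightarrow> A) F" "(g \<longlongrightarrow> B) F"
  shows "((\<lambda>x. f x ** g x) \<longlongrightarrow> A ** B) F"
  unfolding matrix_matrix_mult_def by (intro tendsto_intros assms)

lemma tendsto_matrix_vector_mult [tendsto_intros]:
  fixes f :: "'a \<Rightarrow> real ^ 'n::finite ^ 'm::finite"
  assumes "(f \<longlongrightarrow> A) F" "(g \<longlongrightarrow> v) F"
  shows "((\<lambda>x. f x *v g x) \<longlongrightarrow> A *v v) F"
  unfolding matrix_vector_mult_def by (intro tendsto_intros assms)

lemma tendsto_blk [tendsto_intros]:
  assumes "(f \<longlongrightarrow> A) F"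
  shows "((\<lambda>x. blk r c (f x)) \<longlongrightarrow> blk r c A) F"
  unfolding blk_def by (intro tendsto_intros assms)

text \<open>\<open>matrix_inv\<close> is given by a choice; Cramer's rule replaces it by quotients
  of determinants, whose continuity is visible.\<close>

lemma matrix_inv_cramer:
  fixes A :: "real ^ 'n ^ 'n"
  assumes "det A \<noteq> 0"
  shows "matrix_inv A = (\<chi> i j. det (\<chi> k l. if l = i then axis j 1 $ k else A $ k $ l) / det A)"
proof -
  have "matrix_inv A *v axis j 1 = (\<chi> i. det (\<chi> k l. if l = i then axis j 1 $ k else A $ k $ l) / det A)" for j
    using cramer[OF assms] matrix_inv_vector(2)[OF assms] by blast
  then have "column j (matrix_inv A) = (\<chi> i. det (\<chi> k l. if l = i then axis j 1 $ k else A $ k $ l) / det A)" for j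
    by (simp add: matrix_vector_mult_basis)
  then show ?thesis by (simp add: column_def vec_eq_iff)
qed

lemma tendsto_matrix_inv:
  fixes f :: "'a \<Rightarrow> real ^ 'n ^ 'n"
  assumes f: "(f \<longlongrightarrow> A) F" and A: "det A \<noteq> 0"
  shows "((\<lambda>x. matrix_inv (f x)) \<longlongrightarrow> matrix_inv A) F"
proof -
  define J where "J A = (\<chi> i j. det (\<chi> k l. if l = i then axis j 1 $ k else A $ k $ l) / det A)"
    for A :: "real ^ 'n ^ 'n"
  have ent: "((\<lambda>x. if l = i then axis j 1 $ k else f x $ k $ l) \<longlongrightarrow> (if l = i then axis j 1 $ k else A $ k $ l)) F"
    for i j k l using f by (auto intro!: tendsto_intros)
  have "((\<lambda>x. J (f x)) \<longlongrightarrow> J A) F"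
    unfolding J_def by (intro tendsto_intros f A ent)
  \<comment> \<open>Cramer's formula is available only for nonzero determinants, a condition that
    persists near the limit.\<close>
  moreover have "eventually (\<lambda>x. det (f x) \<noteq> 0) F"
    using tendsto_imp_eventually_ne[OF tendsto_det[OF f] A] .
  ultimately show ?thesis
    unfolding matrix_inv_cramer[OF A] J_def[symmetric]
    by (elim Lim_transform_eventually) (auto elim!: eventually_mono simp: matrix_inv_cramer J_def)
qed

lemma tendsto_gen_of:
  fixes f :: "'a \<Rightarrow> 'd::finite phase_mat"
  assumes "(f \<longlongrightarrow> P) F" "det (blk Inl Inl P) \<noteq> 0"
  shows "((\<lambda>x. gen_of (f x)) \<longlongrightarrow> gen_of P) F"
  unfolding gen_of_def Let_def
  by (intro tendsto_intros tendsto_matrix_inv assms)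

section \<open>Pairs of matrices whose transition is generated\<close>

definition transition :: "'d::finite phase_mat \<times> 'd phase_mat \<Rightarrow> 'd phase_mat" where
  "transition p = fst p ** matrix_inv (snd p)"

text \<open>Posed for all pairs of matrices, so that the set is open in the full product space; the
  condition on \<open>snd p\<close> marks where inversion is continuous. For symplectic pairs,
  membership means exactly that the transition has a generating function.\<close>

definition regular_pairs :: "('d::finite phase_mat \<times> 'd phase_mat) set" where
  "regular_pairs = {p. det (snd p) \<noteq> 0 \<and> det (blk Inl Inl (transition p)) \<noteq> 0}"

lemma tendsto_transition:
  fixes f :: "'a \<Rightarrow> 'd::finite phase_mat \<times> 'd phase_mat"
  assumes "(f \<longlongrightarrow> p) F" "det (snd p) \<noteq> 0"
  shows "((\<lambda>x. transition (f x)) \<longlongrightarrow> transition p) F"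
  unfolding transition_def by (intro tendsto_intros tendsto_matrix_inv assms)

lemma open_regular_pairs: "open (regular_pairs :: ('d::finite phase_mat \<times> 'd phase_mat) set)"
proof -
  let ?S = "{p :: 'd phase_mat \<times> 'd phase_mat. det (snd p) \<noteq> 0}"
  have det: "continuous_on UNIV (\<lambda>p :: 'd phase_mat \<times> 'd phase_mat. det (snd p))"
    unfolding continuous_on_def by (intro ballI tendsto_intros)
  have S: "open ?S"
    using open_Collect_neq[OF det continuous_on_const] .
  have "continuous_on ?S (\<lambda>p. det (blk Inl Inl (transition p)))"
    unfolding continuous_on_def by (auto intro!: tendsto_intros tendsto_transition)
  from continuous_open_preimage[OF this S, of "- {0}"] show ?thesis
    by (simp add: regular_pairs_def Int_def vimage_def open_Compl)
qed

lemma transition_Sp: "fst p \<in> Sp \<Longrightarrow> snd p \<in> Sp \<Longrightarrow> transition p \<in> Sp"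
  by (simp add: transition_def Sp_mult Sp_matrix_inv)

lemma transition_diag: "P \<in> Sp \<Longrightarrow> transition (P, P) = mat 1"
  by (simp add: transition_def matrix_inv_mult Sp_det)

lemma blk_mat_1: "blk Inl Inl (mat 1) = mat 1"
  by (simp add: blk_def mat_def vec_eq_iff)

lemma regular_diag: "P \<in> Sp \<Longrightarrow> (P, P) \<in> regular_pairs"
  by (simp add: regular_pairs_def transition_diag blk_mat_1 Sp_det)

lemma gen_of_mat_1: "gen_of (mat 1) = (0, 0, 0)"
proof -
  have "matrix_inv (mat 1 :: real ^ 'a ^ 'a) = mat 1"
    using matrix_inv_mult(1)[of "mat 1 :: real ^ 'a ^ 'a"] by simp
  moreover have "blk Inl Inr (mat 1) = 0" "blk Inr Inl (mat 1) = 0"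
    by (simp_all add: blk_def mat_def vec_eq_iff)
  ultimately show ?thesis by (simp add: gen_of_def blk_mat_1)
qed

section \<open>The discrete action\<close>

definition config :: "nat \<Rightarrow> (nat \<Rightarrow> 'd::finite phase) \<Rightarrow> (nat \<Rightarrow>\<^sub>0 'd phase)" where
  "config k f = Abs_poly_mapping (\<lambda>i. if i < k then f i else 0)"

lemma lookup_config [simp]: "Poly_Mapping.lookup (config k f) i = (if i < k then f i else 0)"
  unfolding config_def by (subst lookup_Abs_poly_mapping) auto

lemma mem_config_space: "Z \<in> config_space k \<longleftrightarrow> (\<forall>i\<ge>k. Poly_Mapping.lookup Z i = 0)"
proof -
  have "(i \<in> Poly_Mapping.keys Z \<longrightarrow> i < k) \<longleftrightarrow> (i \<ge> k \<longrightarrow> Poly_Mapping.lookup Z i = 0)" for i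
    by (auto simp: in_keys_iff)
  then show ?thesis by (auto simp: config_space_def subset_iff)
qed

lemma config_in_space [simp]: "config k f \<in> config_space k"
  by (simp add: mem_config_space)

lemma subspace_config_space: "subspace (config_space k)"
  by (simp add: subspace_def mem_config_space lookup_add lookup_scaleR_poly_mapping)

lemma single_scaleR: "Poly_Mapping.single k (c *\<^sub>R v) = c *\<^sub>R Poly_Mapping.single k (v :: 'a::real_vector)"
  by (rule poly_mapping_eqI) (simp add: lookup_scaleR_poly_mapping lookup_single when_def)

lemma linear_single: "linear (Poly_Mapping.single k :: 'a::real_vector \<Rightarrow> _)"
  by (intro linearI single_add single_scaleR)

lemma config_space_Suc:
  fixes B :: "(nat \<Rightarrow>\<^sub>0 'd::finite phase) set"
  assumes "config_space k \<subseteq> span B"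
  shows "config_space (Suc k) \<subseteq> span (B \<union> range (\<lambda>i. Poly_Mapping.single k (axis i 1)))"
proof
  fix Z :: "nat \<Rightarrow>\<^sub>0 'd phase" assume Z: "Z \<in> config_space (Suc k)"
  let ?S = "range (\<lambda>i. Poly_Mapping.single k (axis i 1)) :: (nat \<Rightarrow>\<^sub>0 'd phase) set"
  define v where "v = Poly_Mapping.lookup Z k"
  have "Z - Poly_Mapping.single k v \<in> config_space k"
    using Z by (auto simp: mem_config_space lookup_minus lookup_single when_def v_def)
  then have "Z - Poly_Mapping.single k v \<in> span (B \<union> ?S)"
    using assms span_mono[of B "B \<union> ?S"] by blast
  moreover have "Poly_Mapping.single k v \<in> span (B \<union> ?S)"
  proof -
    have "v = (\<Sum>i\<in>UNIV. (v $ i) *\<^sub>R axis i 1)"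
      by (metis (no_types, lifting) basis_expansion scalar_mult_eq_scaleR sum.cong)
    then have "Poly_Mapping.single k v = (\<Sum>i\<in>UNIV. (v $ i) *\<^sub>R Poly_Mapping.single k (axis i 1))"
      by (metis (no_types, lifting) linear_single linear_sum single_scaleR sum.cong)
    then show ?thesis by (simp add: span_base span_scale span_sum)
  qed
  ultimately have "(Z - Poly_Mapping.single k v) + Poly_Mapping.single k v \<in> span (B \<union> ?S)"
    by (rule span_add)
  then show "Z \<in> span (B \<union> ?S)" by simp
qed

lemma fin_dim_config_space: "fin_dim (config_space k :: (nat \<Rightarrow>\<^sub>0 'd::finite phase) set)"
proof (induction k)
  case 0
  have "config_space 0 \<subseteq> span {}"
    by (auto simp: mem_config_space intro: poly_mapping_eqI)
  then show ?case unfolding fin_dim_def by blast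
next
  case (Suc k)
  then obtain S :: "(nat \<Rightarrow>\<^sub>0 'd phase) set" where "finite S" "config_space k \<subseteq> span S"
    by (auto simp: fin_dim_def)
  then show ?case unfolding fin_dim_def using config_space_Suc[of k S] by (meson finite finite_UnI finite_imageI)
qed

text \<open>The upper half of the count in \<open>mas_at_append_identity\<close>, where index and
  coindex each claim \<open>CARD('d)\<close> of the new dimensions.\<close>

lemma dim_config_space_Suc:
  "dim (config_space (Suc k) :: (nat \<Rightarrow>\<^sub>0 'd::finite phase) set)
     \<le> dim (config_space k :: (nat \<Rightarrow>\<^sub>0 'd phase) set) + 2 * CARD('d)"
proof -
  obtain B :: "(nat \<Rightarrow>\<^sub>0 'd phase) set" where B: "finite B" "config_space k \<subseteq> span B" "card B = dim (config_space k :: (nat \<Rightarrow>\<^sub>0 'd phase) set)"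
    using fin_dim_basis[OF fin_dim_config_space] by metis
  let ?S = "range (\<lambda>i. Poly_Mapping.single k (axis i 1)) :: (nat \<Rightarrow>\<^sub>0 'd phase) set"
  have "card ?S \<le> CARD('d + 'd)" by (rule card_image_le) simp
  then have "card (B \<union> ?S) \<le> card B + 2 * CARD('d)"
    using card_Un_le[of B ?S] by (simp add: card_UNIV_sum)
  moreover have "dim (config_space (Suc k) :: (nat \<Rightarrow>\<^sub>0 'd phase) set) \<le> card (B \<union> ?S)"
    by (intro dim_le_card config_space_Suc) (use B in auto)
  ultimately show ?thesis using B by simp
qed

lemma sym_bilinear_hform: "sym_bilinear (hform \<Gamma> k)"
  using hform_bilinear hform_sym unfolding sym_bilinear_def by metis

section \<open>The gradient of the action and its zeros\<close>

lemma cyclic_sum: "(\<Sum>j<k. f (Suc j mod k)) = (\<Sum>j<k. f j)" for f :: "nat \<Rightarrow> real"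
proof (cases k)
  case (Suc n)
  then have "(\<Sum>j<k. f (Suc j mod k)) = (\<Sum>j<n. f (Suc j mod k)) + f 0" by simp
  also have "(\<Sum>j<n. f (Suc j mod k)) = (\<Sum>j<n. f (Suc j))" by (rule sum.cong) (auto simp: Suc)
  finally show ?thesis unfolding Suc sum.lessThan_Suc_shift by simp
qed simp

lemma gen_value_polar:
  assumes "transpose A = A" "transpose C = C"
  shows "gen_value (A, B, C) (X + X') (Y + Y') - gen_value (A, B, C) X Y - gen_value (A, B, C) X' Y'
    = (A *v X + transpose B *v Y) \<bullet> X' + (B *v X + C *v Y) \<bullet> Y'"
proof -
  have A: "(A *v x) \<bullet> y = (A *v y) \<bullet> x" for x y
    by (metis assms(1) dot_lmul_matrix inner_commute transpose_matrix_vector)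
  have C: "(C *v x) \<bullet> y = (C *v y) \<bullet> x" for x y
    by (metis assms(2) dot_lmul_matrix inner_commute transpose_matrix_vector)
  have B: "(transpose B *v Y) \<bullet> X' = (B *v X') \<bullet> Y"
    by (metis dot_lmul_matrix inner_commute transpose_matrix_vector)
  show ?thesis
    using A[of X X'] C[of Y Y'] unfolding inner_add_left B
    by (simp add: matrix_vector_right_distrib inner_simps field_simps)
qed

text \<open>When the steps are generated by their \<open>gen_fun\<close>, this is the gradient of
  the action. Entry \<open>j\<close> collects the derivatives in \<open>X_(j+1)\<close> and
  \<open>Y_j\<close>, the two arguments of \<open>f_j\<close>, so that its vanishing is the
  generating relation of step \<open>j\<close> alone.\<close>

definition defect :: "(real \<Rightarrow> 'd::finite phase_mat) \<Rightarrow> nat \<Rightarrow> (nat \<Rightarrow>\<^sub>0 'd phase) \<Rightarrow> nat \<Rightarrow> 'd phase" where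
  "defect \<Gamma> k Z j =
     (let (A, B, C) = gen_fun (step_mat \<Gamma> k j);
          z = Poly_Mapping.lookup Z j; z' = Poly_Mapping.lookup Z (Suc j mod k)
      in phase_join (ypart z - ypart z' + A *v xpart z' + transpose B *v ypart z)
           (xpart z' - xpart z + B *v xpart z' + C *v ypart z))"

lemma generates_defect_eq_0_iff:
  assumes "generates (gen_fun (step_mat \<Gamma> k j)) (step_mat \<Gamma> k j)"
  shows "defect \<Gamma> k Z j = 0 \<longleftrightarrow>
    step_mat \<Gamma> k j *v Poly_Mapping.lookup Z j = Poly_Mapping.lookup Z (Suc j mod k)"
proof -
  obtain A B C where F: "gen_fun (step_mat \<Gamma> k j) = (A, B, C)" by (metis prod_cases3)
  define z z' where "z = Poly_Mapping.lookup Z j" "z' = Poly_Mapping.lookup Z (Suc j mod k)"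
  have "defect \<Gamma> k Z j = phase_join (ypart z - ypart z' + A *v xpart z' + transpose B *v ypart z)
      (xpart z' - xpart z + B *v xpart z' + C *v ypart z)"
    by (simp add: defect_def F z_z'_def Let_def)
  then have "defect \<Gamma> k Z j = 0 \<longleftrightarrow>
      ypart z - ypart z' + A *v xpart z' + transpose B *v ypart z = 0 \<and>
      xpart z' - xpart z + B *v xpart z' + C *v ypart z = 0"
    by (simp add: phase_eq_iff del: transpose_matrix_vector)
  also have "\<dots> \<longleftrightarrow> xpart z' - xpart z = - (B *v xpart z') - C *v ypart z \<and>
      ypart z' - ypart z = A *v xpart z' + transpose B *v ypart z"
  proof -
    have "a - b + c + d = 0 \<longleftrightarrow> b - a = c + d" "b - a + c + d = 0 \<longleftrightarrow> b - a = - c - d"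
      for a b c d :: "real ^ 'a"
      by (auto simp: algebra_simps add_eq_0_iff2)
    then show ?thesis by metis
  qed
  also have "\<dots> \<longleftrightarrow> step_mat \<Gamma> k j *v z = z'"
    using assms unfolding F generates.simps by blast
  finally show ?thesis by (simp only: z_z'_def)
qed

text \<open>Summation by parts on the cycle. Polarizing \<open>Y_j \<bullet> (X_(j+1) - X_j)\<close>
  pairs \<open>Y_j\<close> of \<open>Z\<close> with \<open>X_j\<close> of \<open>W\<close>; a cyclic
  shift of the index turns this into \<open>Y_(j+1)\<close> against \<open>X_(j+1)\<close>, which
  belongs to the derivative in \<open>X_(j+1)\<close>.\<close>

lemma hform_defect:
  assumes gen: "\<And>j. j < k \<Longrightarrow> generates (gen_fun (step_mat \<Gamma> k j)) (step_mat \<Gamma> k j)"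
  shows "hform \<Gamma> k Z W = (\<Sum>j<k. xpart (defect \<Gamma> k Z j) \<bullet> xpart (Poly_Mapping.lookup W (Suc j mod k))
     + ypart (defect \<Gamma> k Z j) \<bullet> ypart (Poly_Mapping.lookup W j))"
proof -
  let ?x = "\<lambda>Z i. xpart (Poly_Mapping.lookup Z (i mod k))"
  let ?y = "\<lambda>Z i. ypart (Poly_Mapping.lookup Z (i mod k))"
  \<comment> \<open>\<open>?r\<close> and \<open>?l\<close> are the summand before and after the
    shift; their sums over the cycle agree by \<open>cyclic_sum\<close>.\<close>
  let ?r = "\<lambda>j. ?y Z j \<bullet> ?x W (Suc j) - ?y Z j \<bullet> ?x W j"
  let ?l = "\<lambda>j. ?y Z j \<bullet> ?x W (Suc j) - ?y Z (Suc j) \<bullet> ?x W (Suc j)"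
  let ?t = "\<lambda>j. xpart (defect \<Gamma> k Z j) \<bullet> ?x W (Suc j) + ypart (defect \<Gamma> k Z j) \<bullet> ?y W j"
  have "hform \<Gamma> k Z W = (\<Sum>j<k. ?t j - ?l j + ?r j)"
    unfolding hform_def action_def sum_subtractf[symmetric]
  proof (rule sum.cong[OF refl])
    fix j assume "j \<in> {..<k}"
    then have j: "j < k" by simp
    obtain A B C where F: "gen_fun (step_mat \<Gamma> k j) = (A, B, C)" by (metis prod_cases3)
    have sym: "transpose A = A" "transpose C = C" using gen[OF j] by (simp_all add: F)
    show "(let X = \<lambda>i. ?x (Z + W) i; Y = \<lambda>i. ?y (Z + W) i
          in Y j \<bullet> (X (j + 1) - X j) + gen_value (gen_fun (step_mat \<Gamma> k j)) (X (j + 1)) (Y j)) -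
         (let X = \<lambda>i. ?x Z i; Y = \<lambda>i. ?y Z i
          in Y j \<bullet> (X (j + 1) - X j) + gen_value (gen_fun (step_mat \<Gamma> k j)) (X (j + 1)) (Y j)) -
         (let X = \<lambda>i. ?x W i; Y = \<lambda>i. ?y W i
          in Y j \<bullet> (X (j + 1) - X j) + gen_value (gen_fun (step_mat \<Gamma> k j)) (X (j + 1)) (Y j))
        = ?t j - ?l j + ?r j"
      using gen_value_polar[OF sym, of B "?x Z (j + 1)" "?x W (j + 1)" "?y Z j" "?y W j"] j
      by (simp del: gen_value.simps add: F Let_def lookup_add defect_def inner_simps)
        (simp add: algebra_simps inner_commute)
  qed
  also have "\<dots> = (\<Sum>j<k. ?t j) + ((\<Sum>j<k. ?y Z (Suc j) \<bullet> ?x W (Suc j)) - (\<Sum>j<k. ?y Z j \<bullet> ?x W j))"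
    by (simp add: sum.distrib sum_subtractf)
  also have "(\<Sum>j<k. ?y Z (Suc j) \<bullet> ?x W (Suc j)) = (\<Sum>j<k. ?y Z j \<bullet> ?x W j)"
    using cyclic_sum[of "\<lambda>j. ?y Z j \<bullet> ?x W j" k] by simp
  finally show ?thesis by simp
qed

lemma Suc_mod_inj: "i < k \<Longrightarrow> j < k \<Longrightarrow> Suc i mod k = Suc j mod k \<Longrightarrow> i = j"
  by (auto simp: mod_Suc split: if_splits)

lemma radical_hform:
  assumes gen: "\<And>j. j < k \<Longrightarrow> generates (gen_fun (step_mat \<Gamma> k j)) (step_mat \<Gamma> k j)"
  shows "radical_on (config_space k) (hform \<Gamma> k) =
    {Z \<in> config_space k. \<forall>j<k. step_mat \<Gamma> k j *v Poly_Mapping.lookup Z j = Poly_Mapping.lookup Z (Suc j mod k)}"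
proof -
  have "(\<forall>W\<in>config_space k. hform \<Gamma> k Z W = 0) \<longleftrightarrow> (\<forall>j<k. defect \<Gamma> k Z j = 0)" (is "?L \<longleftrightarrow> ?R") for Z
  proof
    assume L: ?L
    show ?R
    proof (intro allI impI)
      fix j assume j: "j < k"
      let ?g = "defect \<Gamma> k Z j"
      \<comment> \<open>A test configuration supported in the single variable \<open>Y_j\<close>,
        and below one supported in \<open>X_(j+1)\<close>, isolates one component of the
        gradient.\<close>
      have "(0::real) = hform \<Gamma> k Z (config k (\<lambda>i. if i = j then phase_join 0 (ypart ?g) else 0))"
        using L by simp
      also have "\<dots> = (\<Sum>i<k. if i = j then ypart ?g \<bullet> ypart ?g else 0)"
        by (subst hform_defect, erule gen, rule sum.cong) auto
      finally have y: "ypart ?g = 0" using j by simp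
      have "(0::real) = hform \<Gamma> k Z (config k (\<lambda>i. if i = Suc j mod k then phase_join (xpart ?g) 0 else 0))"
        using L by simp
      also have "\<dots> = (\<Sum>i<k. if i = j then xpart ?g \<bullet> xpart ?g else 0)"
      proof (subst hform_defect, erule gen, rule sum.cong)
        fix i assume "i \<in> {..<k}"
        \<comment> \<open>The cyclic successor is injective, so only the summand
          \<open>i = j\<close> meets the support of the test configuration.\<close>
        then have i: "(Suc i mod k = Suc j mod k) = (i = j)" and k: "Suc i mod k < k"
          using j Suc_mod_inj by auto
        show "xpart (defect \<Gamma> k Z i) \<bullet> xpart (Poly_Mapping.lookup
              (config k (\<lambda>i. if i = Suc j mod k then phase_join (xpart ?g) 0 else 0)) (Suc i mod k)) +
            ypart (defect \<Gamma> k Z i) \<bullet> ypart (Poly_Mapping.lookup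
              (config k (\<lambda>i. if i = Suc j mod k then phase_join (xpart ?g) 0 else 0)) i)
          = (if i = j then xpart ?g \<bullet> xpart ?g else 0)"
          using k by (cases "i = j") (simp_all add: i)
      qed simp
      finally have "xpart ?g = 0" using j by simp
      with y show "?g = 0" by (simp add: phase_eq_iff)
    qed
  next
    assume R: ?R
    show ?L
      by (intro ballI, subst hform_defect, erule gen) (simp add: R)
  qed
  then show ?thesis
    unfolding radical_on_def using generates_defect_eq_0_iff[OF gen] by auto
qed

text \<open>What the discrete form sees of a path: its values on the grid. This makes it applicable
  to time changes \<open>\<Gamma> (\<tau> u)\<close>, whose values off the unit interval are
  arbitrary. The normalization at 0 makes the product of all steps equal to
  \<open>\<Gamma> 1\<close>.\<close>

definition admissible :: "nat \<Rightarrow> (real \<Rightarrow> 'd::finite phase_mat) \<Rightarrow> bool" where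
  "admissible k \<Gamma> \<longleftrightarrow> k \<ge> 1 \<and> \<Gamma> 0 = mat 1 \<and> (\<forall>j\<le>k. \<Gamma> (real j / real k) \<in> Sp) \<and>
     (\<forall>j<k. (\<Gamma> (real (Suc j) / real k), \<Gamma> (real j / real k)) \<in> regular_pairs)"

lemma step_mat_transition: "step_mat \<Gamma> k j = transition (\<Gamma> (real (Suc j) / real k), \<Gamma> (real j / real k))"
  by (simp add: step_mat_def transition_def)

lemma admissible_step:
  assumes "admissible k \<Gamma>" "j < k"
  shows "step_mat \<Gamma> k j \<in> Sp" "det (blk Inl Inl (step_mat \<Gamma> k j)) \<noteq> 0"
    "gen_fun (step_mat \<Gamma> k j) = gen_of (step_mat \<Gamma> k j)"
    "generates (gen_fun (step_mat \<Gamma> k j)) (step_mat \<Gamma> k j)"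
proof -
  show 1: "step_mat \<Gamma> k j \<in> Sp"
    unfolding step_mat_transition by (intro transition_Sp) (use assms in \<open>auto simp: admissible_def simp del: of_nat_Suc\<close>)
  show 2: "det (blk Inl Inl (step_mat \<Gamma> k j)) \<noteq> 0"
    unfolding step_mat_transition using assms by (auto simp: admissible_def regular_pairs_def simp del: of_nat_Suc)
  show "gen_fun (step_mat \<Gamma> k j) = gen_of (step_mat \<Gamma> k j)"
    using 1 2 by (rule gen_fun_eq_gen_of)
  then show "generates (gen_fun (step_mat \<Gamma> k j)) (step_mat \<Gamma> k j)"
    using generates_gen_of[OF 1 2] by simp
qed

lemma step_mat_apply:
  assumes "admissible k \<Gamma>" "j < k"
  shows "step_mat \<Gamma> k j *v (\<Gamma> (real j / real k) *v v) = \<Gamma> (real (Suc j) / real k) *v v"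
proof -
  have "det (\<Gamma> (real j / real k)) \<noteq> 0" using assms by (auto simp: admissible_def intro!: Sp_det)
  then show ?thesis
    by (simp add: step_mat_def matrix_vector_mul_assoc[symmetric] matrix_inv_vector)
qed

lemma nullity_hform:
  assumes adm: "admissible k \<Gamma>"
  shows "dim (radical_on (config_space k) (hform \<Gamma> k)) = dim {v. (\<Gamma> 1 - mat 1) *v v = 0}"
proof -
  have k: "k \<ge> 1" and G0: "\<Gamma> 0 = mat 1" using adm by (auto simp: admissible_def)
  \<comment> \<open>The discrete trajectory through \<open>v\<close>; entry 0 returns
    \<open>v\<close>, so \<open>E\<close> is injective.\<close>
  define E where "E v = config k (\<lambda>j. \<Gamma> (real j / real k) *v v)" for v
  let ?K = "{v. (\<Gamma> 1 - mat 1) *v v = 0}"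
  have K: "v \<in> ?K \<longleftrightarrow> \<Gamma> 1 *v v = v" for v by (simp add: matrix_vector_mult_diff_rdistrib)
  have rad: "radical_on (config_space k) (hform \<Gamma> k) =
    {Z \<in> config_space k. \<forall>j<k. step_mat \<Gamma> k j *v Poly_Mapping.lookup Z j = Poly_Mapping.lookup Z (Suc j mod k)}"
    using admissible_step(4)[OF adm] by (rule radical_hform)
  have lin: "linear E"
    by (intro linearI poly_mapping_eqI)
       (simp_all add: E_def lookup_add lookup_scaleR_poly_mapping matrix_vector_right_distrib matrix_vector_mult_scaleR)
  have E0: "Poly_Mapping.lookup (E v) 0 = v" for v using k G0 by (simp add: E_def)
  have "E ` ?K = radical_on (config_space k) (hform \<Gamma> k)"
  proof (intro equalityI subsetI)
    fix Z assume "Z \<in> E ` ?K"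
    then obtain v where v: "Z = E v" "\<Gamma> 1 *v v = v" using K by blast
    have "step_mat \<Gamma> k j *v Poly_Mapping.lookup Z j = Poly_Mapping.lookup Z (Suc j mod k)" if j: "j < k" for j
    proof (cases "Suc j < k")
      case True then show ?thesis using step_mat_apply[OF adm j, of v] j by (simp add: v(1) E_def)
    next
      case False
      then have "Suc j = k" using j by simp
      then show ?thesis using step_mat_apply[OF adm j, of v] j v(2) k G0 by (simp add: v(1) E_def)
    qed
    then show "Z \<in> radical_on (config_space k) (hform \<Gamma> k)" unfolding rad by (simp add: v(1) E_def)
  next
    fix Z assume "Z \<in> radical_on (config_space k) (hform \<Gamma> k)"
    then have Z: "Z \<in> config_space k"
      and step: "\<And>j. j < k \<Longrightarrow> step_mat \<Gamma> k j *v Poly_Mapping.lookup Z j = Poly_Mapping.lookup Z (Suc j mod k)"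
      unfolding rad by auto
    define v where "v = Poly_Mapping.lookup Z 0"
    have Zj: "Poly_Mapping.lookup Z j = \<Gamma> (real j / real k) *v v" if "j < k" for j
      using that
    proof (induction j)
      case 0 then show ?case by (simp add: G0 v_def)
    next
      case (Suc j)
      then show ?case using step[of j] step_mat_apply[OF adm, of j v] by simp
    qed
    obtain n where n: "k = Suc n" using k by (cases k) auto
    \<comment> \<open>At the last index the successor is 0 modulo \<open>k\<close>, so the step
      relation closes the trajectory.\<close>
    have "\<Gamma> 1 *v v = v"
      using step[of n] Zj[of n] step_mat_apply[OF adm, of n v] by (simp add: n v_def)
    moreover have "Z = E v"
      using Zj Z by (intro poly_mapping_eqI) (simp add: E_def mem_config_space)
    ultimately show "Z \<in> E ` ?K" using K by blast
  qed
  moreover have "dim (E ` ?K) = dim ?K"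
    using E0 by (intro eucl.dim_image_eq lin) (metis inj_onI)
  ultimately show ?thesis by simp
qed

section \<open>Continuity of the discrete form in the path\<close>

lemma tendsto_gen_value:
  assumes "(f \<longlongrightarrow> G) F"
  shows "((\<lambda>x. gen_value (f x) X Y) \<longlongrightarrow> gen_value G X Y) F"
proof -
  have "gen_value G X Y = 1/2 * ((fst G *v X) \<bullet> X) + (fst (snd G) *v X) \<bullet> Y + 1/2 * ((snd (snd G) *v Y) \<bullet> Y)" for G
    by (cases G) simp
  then show ?thesis
    by (simp only:) (intro tendsto_intros assms)
qed

lemma tendsto_hform:
  assumes "\<And>j. j < k \<Longrightarrow> ((\<lambda>x. gen_fun (step_mat (G x) k j)) \<longlongrightarrow> gen_fun (step_mat \<Gamma> k j)) F"
  shows "((\<lambda>x. hform (G x) k Z W) \<longlongrightarrow> hform \<Gamma> k Z W) F"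
proof -
  have "((\<lambda>x. action (G x) k Z) \<longlongrightarrow> action \<Gamma> k Z) F" for Z
    unfolding action_def Let_def
    by (intro tendsto_sum tendsto_add tendsto_const tendsto_gen_value assms) simp
  then show ?thesis unfolding hform_def by (intro tendsto_diff)
qed

lemma tendsto_hform_admissible:
  assumes adm: "admissible k \<Gamma>" "eventually (\<lambda>x. admissible k (G x)) F"
    and lim: "\<And>j. j \<le> k \<Longrightarrow> ((\<lambda>x. G x (real j / real k)) \<longlongrightarrow> \<Gamma> (real j / real k)) F"
  shows "((\<lambda>x. hform (G x) k Z W) \<longlongrightarrow> hform \<Gamma> k Z W) F"
proof (rule tendsto_hform)
  fix j assume j: "j < k"
  have "det (\<Gamma> (real j / real k)) \<noteq> 0" using adm(1) j by (auto simp: admissible_def intro!: Sp_det)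
  then have "((\<lambda>x. step_mat (G x) k j) \<longlongrightarrow> step_mat \<Gamma> k j) F"
    unfolding step_mat_transition using lim[of j] lim[of "Suc j"] j
    by (intro tendsto_transition tendsto_Pair) auto
  then have "((\<lambda>x. gen_of (step_mat (G x) k j)) \<longlongrightarrow> gen_of (step_mat \<Gamma> k j)) F"
    by (rule tendsto_gen_of) (rule admissible_step(2)[OF adm(1) j])
  \<comment> \<open>\<open>gen_fun\<close> is a definite description; admissibility, which holds
    near the limit, identifies it with the continuous formula \<open>gen_of\<close>.\<close>
  then show "((\<lambda>x. gen_fun (step_mat (G x) k j)) \<longlongrightarrow> gen_fun (step_mat \<Gamma> k j)) F"
    unfolding admissible_step(3)[OF adm(1) j]
    by (rule Lim_transform_eventually)
       (use adm(2) j in \<open>auto elim!: eventually_mono simp: admissible_step(3)\<close>)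
qed

lemma mas_at_lower_semicontinuous:
  assumes adm: "admissible k \<Gamma>" "eventually (\<lambda>x. admissible k (G x)) F"
    and lim: "\<And>j. j \<le> k \<Longrightarrow> ((\<lambda>x. G x (real j / real k)) \<longlongrightarrow> \<Gamma> (real j / real k)) F"
  shows "eventually (\<lambda>x. mas_at k \<Gamma> \<le> mas_at k (G x)) F"
    "eventually (\<lambda>x. comas_at k \<Gamma> \<le> comas_at k (G x)) F"
proof -
  have "eventually (\<lambda>x. ind_on (config_space k) (hform \<Gamma> k) \<le> ind_on (config_space k) (hform (G x) k)) F"
    by (intro ind_on_lower_semicontinuous sym_bilinear_hform fin_dim_config_space subspace_config_space
        tendsto_hform_admissible assms)
  then show "eventually (\<lambda>x. mas_at k \<Gamma> \<le> mas_at k (G x)) F"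
    by eventually_elim (simp add: mas_at_def)
  have "eventually (\<lambda>x. coind_on (config_space k) (hform \<Gamma> k) \<le> coind_on (config_space k) (hform (G x) k)) F"
    by (intro coind_on_lower_semicontinuous sym_bilinear_hform fin_dim_config_space subspace_config_space
        tendsto_hform_admissible assms)
  then show "eventually (\<lambda>x. comas_at k \<Gamma> \<le> comas_at k (G x)) F"
    by eventually_elim (simp add: comas_at_def)
qed

lemma mas_at_locally_constant:
  assumes adm: "admissible k \<Gamma>" "eventually (\<lambda>x. admissible k (G x)) F"
    and lim: "\<And>j. j \<le> k \<Longrightarrow> ((\<lambda>x. G x (real j / real k)) \<longlongrightarrow> \<Gamma> (real j / real k)) F"
    and null: "eventually (\<lambda>x. dim {v. (G x 1 - mat 1) *v v = 0} = dim {v. (\<Gamma> 1 - mat 1) *v v = 0}) F"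
  shows "eventually (\<lambda>x. mas_at k (G x) = mas_at k \<Gamma> \<and> comas_at k (G x) = comas_at k \<Gamma>) F"
proof -
  have "eventually (\<lambda>x. dim (radical_on (config_space k) (hform (G x) k)) =
      dim (radical_on (config_space k) (hform \<Gamma> k))) F"
    using adm(2) null by eventually_elim (simp add: nullity_hform adm(1))
  then have "eventually (\<lambda>x. ind_on (config_space k) (hform (G x) k) = ind_on (config_space k) (hform \<Gamma> k) \<and>
      coind_on (config_space k) (hform (G x) k) = coind_on (config_space k) (hform \<Gamma> k)) F"
    by (intro index_locally_constant sym_bilinear_hform fin_dim_config_space subspace_config_space
        tendsto_hform_admissible adm lim)
  then show ?thesis
    by eventually_elim (simp add: mas_at_def comas_at_def)
qed

section \<open>Appending an identity step\<close>

lemma ind_on_extend: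
  fixes T :: "'v::real_vector \<Rightarrow> real ^ 'd::finite \<Rightarrow> 'w::real_vector"
  assumes h: "sym_bilinear h" "fin_dim V" "subspace V" and h': "sym_bilinear h'" "fin_dim V'" "subspace V'"
    and T: "\<And>z u. z \<in> V \<Longrightarrow> T z u \<in> V'"
      "\<And>z u z' u'. z \<in> V \<Longrightarrow> z' \<in> V \<Longrightarrow> h' (T z u) (T z' u') = h z z' - 2 * (u \<bullet> u')"
  shows "ind_on V h + CARD('d) \<le> ind_on V' h'"
proof -
  obtain B where B: "orth_family h B" "B \<subseteq> V" "\<And>b. b \<in> B \<Longrightarrow> h b b < 0" "card B = ind_on V h"
    using ind_on_orth_family[OF h] by blast
  have fB: "finite B" using B by (simp add: orth_family_def)
  \<comment> \<open>Through \<open>T\<close> the form becomes \<open>h\<close> plus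
    \<open>- 2 * (u \<bullet> u)\<close>, so a negative family of \<open>V\<close> at
    \<open>u = 0\<close> and the unit vectors at \<open>z = 0\<close> together are orthogonal and
    negative. The factor 2 stems from polarizing \<open>- (u \<bullet> u)\<close>.\<close>
  define b where "b i = (case i of Inl z \<Rightarrow> T z 0 | Inr i \<Rightarrow> T 0 (axis i 1))" for i
  have 0: "0 \<in> V" by (rule subspace_0[OF h(3)])
  have "card (B <+> (UNIV :: 'd set)) \<le> ind_on V' h'"
  proof (rule card_le_ind_on[OF h', where b = b])
    show "finite (B <+> (UNIV :: 'd set))" using fB by simp
    fix i assume i: "i \<in> B <+> (UNIV :: 'd set)"
    show "b i \<in> V'" using i B(2) 0 T(1) by (auto simp: b_def)
    show "h' (b i) (b i) < 0" using i B(2,3) 0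
      by (auto simp: b_def T(2) sym_bilinear_simps[OF h(1)] subset_iff inner_axis_axis)
    fix j assume j: "j \<in> B <+> (UNIV :: 'd set)" "i \<noteq> j"
    have orth: "x = y" if "x \<in> B" "y \<in> B" "h x y \<noteq> 0" for x y
      using B(1) that by (auto simp: orth_family_def pairwise_def)
    show "h' (b i) (b j) = 0" using i j B(2) 0
      by (auto simp: b_def T(2) sym_bilinear_simps[OF h(1)] subset_iff inner_axis_axis
          intro: orth split: if_splits)
  qed
  then show ?thesis using B(4) fB by (simp add: card_Plus)
qed

text \<open>
  Appending the identity to the chain of steps adds the summand \<open>U \<bullet> V\<close> to the action, where
  \<open>U = X\<^sub>k - X\<^sub>0\<close> and \<open>V = Y\<^sub>k\<^sub>-\<^sub>1 + A X\<^sub>0 + 1/2 A U + B\<^sup>T Y\<^sub>k\<^sub>-\<^sub>1 - Y\<^sub>k\<close>. The map below is the section with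
  \<open>V = s U\<close>.
\<close>

definition extend_config :: "'d::finite quad_gen \<Rightarrow> nat \<Rightarrow> real \<Rightarrow> (nat \<Rightarrow>\<^sub>0 'd phase) \<Rightarrow> real ^ 'd \<Rightarrow> (nat \<Rightarrow>\<^sub>0 'd phase)" where
  "extend_config F k s Z u = (let (A, B, C) = F;
      x = xpart (Poly_Mapping.lookup Z 0); y = ypart (Poly_Mapping.lookup Z (k - 1))
    in Z + Poly_Mapping.single k
        (phase_join (x + u) (y + A *v x + (1/2) *\<^sub>R (A *v u) + transpose B *v y - s *\<^sub>R u)))"

lemma phase_join_add: "phase_join x y + phase_join x' y' = phase_join (x + x') (y + y')"
  by (simp add: phase_eq_iff)

text \<open>\<open>hform\<close> is a difference of action values at sums; additivity lets the
  diagonal formula \<open>action_extend_config\<close> determine it off the diagonal as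
  well.\<close>

lemma extend_config_add: "extend_config F k s (Z + W) (u + w) = extend_config F k s Z u + extend_config F k s W w"
proof -
  obtain A B C where F: "F = (A, B, C)" by (metis prod_cases3)
  define v where "v Z u = (let x = xpart (Poly_Mapping.lookup Z 0); y = ypart (Poly_Mapping.lookup Z (k - 1)) in
      phase_join (x + u) (y + A *v x + (1/2) *\<^sub>R (A *v u) + transpose B *v y - s *\<^sub>R u))" for Z u
  have "v (Z + W) (u + w) = v Z u + v W w"
    unfolding v_def Let_def phase_join_add lookup_add xpart_simps ypart_simps
      matrix_vector_right_distrib scaleR_add_right
    by (simp add: phase_eq_iff algebra_simps)
  then have "Poly_Mapping.single k (v (Z + W) (u + w)) = Poly_Mapping.single k (v Z u) + Poly_Mapping.single k (v W w)"
    by (simp add: single_add)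
  moreover have "extend_config F k s Z u = Z + Poly_Mapping.single k (v Z u)" for Z u
    by (simp add: extend_config_def F v_def Let_def)
  ultimately show ?thesis by (simp add: algebra_simps)
qed

lemma extend_config_in_space: "Z \<in> config_space k \<Longrightarrow> extend_config F k s Z u \<in> config_space (Suc k)"
  by (cases F) (simp add: extend_config_def Let_def mem_config_space lookup_add lookup_single when_def)

text \<open>Only the last two summands see the new entry. The old last step now ends at
  \<open>x0 + u\<close> instead of \<open>x0\<close>, and the identity step contributes
  \<open>- (yk \<bullet> u)\<close>. The terms of \<open>yk\<close> cancel the change in the former,
  the half of \<open>A *v u\<close> matching its quadratic part, up to
  \<open>s * (u \<bullet> u)\<close>.\<close>

lemma action_extend_config:
  assumes step: "\<And>j. j < k \<Longrightarrow> step_mat \<Gamma>' (Suc k) j = step_mat \<Gamma> k j" "step_mat \<Gamma>' (Suc k) k = mat 1"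
    and k: "k = Suc n" and F: "gen_fun (step_mat \<Gamma> k n) = F" "generates F (step_mat \<Gamma> k n)"
    and Z: "Z \<in> config_space k"
  shows "action \<Gamma>' (Suc k) (extend_config F k s Z u) = action \<Gamma> k Z + s * (u \<bullet> u)"
proof -
  obtain A B C where F': "F = (A, B, C)" by (metis prod_cases3)
  have sym: "transpose A = A" using F(2) by (simp add: F')
  have A: "(A *v x) \<bullet> y = (A *v y) \<bullet> x" for x y
    by (metis sym dot_lmul_matrix inner_commute transpose_matrix_vector)
  have B: "(transpose B *v y) \<bullet> x = (B *v x) \<bullet> y" for x y
    by (metis dot_lmul_matrix inner_commute transpose_matrix_vector)
  define E where "E = extend_config F k s Z u"
  define x0 y where "x0 = xpart (Poly_Mapping.lookup Z 0)" "y = ypart (Poly_Mapping.lookup Z n)"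
  have Elow: "Poly_Mapping.lookup E j = Poly_Mapping.lookup Z j" if "j < k" for j
    using that by (simp add: E_def extend_config_def F' Let_def lookup_add lookup_single when_def)
  have Ek: "Poly_Mapping.lookup E k =
      phase_join (x0 + u) (y + A *v x0 + (1/2) *\<^sub>R (A *v u) + transpose B *v y - s *\<^sub>R u)"
    using Z by (simp add: E_def extend_config_def F' Let_def lookup_add mem_config_space x0_y_def k)
  have id: "gen_fun (mat 1 :: 'a phase_mat) = (0, 0, 0)"
    by (simp add: gen_fun_eq_gen_of gen_of_mat_1 blk_mat_1)
  define f where "f \<Gamma> k Z j = (let X = \<lambda>i. xpart (Poly_Mapping.lookup Z (i mod k));
                 Y = \<lambda>i. ypart (Poly_Mapping.lookup Z (i mod k))
             in Y j \<bullet> (X (j + 1) - X j) + gen_value (gen_fun (step_mat \<Gamma> k j)) (X (j + 1)) (Y j))"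
    for \<Gamma> :: "real \<Rightarrow> 'a phase_mat" and k Z j
  have "action \<Gamma>' (Suc k) E = (\<Sum>j<n. f \<Gamma>' (Suc k) E j) + (f \<Gamma>' (Suc k) E n + f \<Gamma>' (Suc k) E k)"
    by (simp add: action_def f_def k)
  also have "(\<Sum>j<n. f \<Gamma>' (Suc k) E j) = (\<Sum>j<n. f \<Gamma> k Z j)"
    by (rule sum.cong) (simp_all add: f_def Let_def step(1)[unfolded k] Elow k)
  also have "f \<Gamma>' (Suc k) E n + f \<Gamma>' (Suc k) E k = f \<Gamma> k Z n + s * (u \<bullet> u)"
  proof -
    define xn where "xn = xpart (Poly_Mapping.lookup Z n)"
    define yk where "yk = y + A *v x0 + (1/2) *\<^sub>R (A *v u) + transpose B *v y - s *\<^sub>R u"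
    have "f \<Gamma>' (Suc k) E n = y \<bullet> (x0 + u - xn) + gen_value (A, B, C) (x0 + u) y"
      using Elow[of n] Ek F step(1)[of n] by (simp add: f_def Let_def k x0_y_def xn_def F' del: gen_value.simps)
    \<comment> \<open>The successor of \<open>k\<close> modulo \<open>Suc k\<close> is 0, so this
      step leads from \<open>x0 + u\<close> back to \<open>x0\<close>, and its generating function
      vanishes.\<close>
    moreover have "f \<Gamma>' (Suc k) E k = - (yk \<bullet> u)"
    proof -
      have "xpart (Poly_Mapping.lookup E 0) = x0" "Poly_Mapping.lookup E k = phase_join (x0 + u) yk"
        using Elow[of 0] Ek k by (simp_all add: x0_y_def yk_def)
      then show ?thesis using step(2) by (simp add: f_def Let_def id)
    qed
    moreover have "f \<Gamma> k Z n = y \<bullet> (x0 - xn) + gen_value (A, B, C) x0 y"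
      using F by (simp add: f_def Let_def k x0_y_def xn_def F' del: gen_value.simps)
    moreover have "yk \<bullet> u = y \<bullet> u + (A *v x0) \<bullet> u + 1/2 * ((A *v u) \<bullet> u) + (B *v u) \<bullet> y - s * (u \<bullet> u)"
      unfolding yk_def inner_simps B by simp
    ultimately show ?thesis
      using A[of x0 u] by (simp add: matrix_vector_right_distrib inner_simps field_simps)
  qed
  also have "(\<Sum>j<n. f \<Gamma> k Z j) + (f \<Gamma> k Z n + s * (u \<bullet> u)) = action \<Gamma> k Z + s * (u \<bullet> u)"
    by (simp add: action_def f_def k)
  finally show ?thesis by (simp add: E_def)
qed

text \<open>The sections with \<open>s = -1\<close> and \<open>s = 1\<close> provide
  \<open>d\<close> new negative and \<open>d\<close> new positive directions. The nullity is
  unchanged, as both paths end at the same matrix, and the dimension grows by at most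
  \<open>2 d\<close>, so both lower bounds are attained.\<close>

lemma mas_at_append_identity:
  fixes \<Gamma> \<Gamma>' :: "real \<Rightarrow> 'd::finite phase_mat"
  assumes adm: "admissible k \<Gamma>" "admissible (Suc k) \<Gamma>'" and end_eq: "\<Gamma>' 1 = \<Gamma> 1"
    and step: "\<And>j. j < k \<Longrightarrow> step_mat \<Gamma>' (Suc k) j = step_mat \<Gamma> k j" "step_mat \<Gamma>' (Suc k) k = mat 1"
  shows "mas_at (Suc k) \<Gamma>' = mas_at k \<Gamma>" "comas_at (Suc k) \<Gamma>' = comas_at k \<Gamma>"
proof -
  obtain n where n: "k = Suc n" using adm(1) by (cases k) (auto simp: admissible_def)
  define F where "F = gen_fun (step_mat \<Gamma> k n)"
  have F: "generates F (step_mat \<Gamma> k n)" unfolding F_def by (rule admissible_step(4)[OF adm(1)]) (simp add: n)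
  define V V' :: "(nat \<Rightarrow>\<^sub>0 'd phase) set" where "V = config_space k" "V' = config_space (Suc k)"
  define h h' where "h = hform \<Gamma> k" "h' = hform \<Gamma>' (Suc k)"
  have hs: "sym_bilinear h" "fin_dim V" "subspace V" and hs': "sym_bilinear h'" "fin_dim V'" "subspace V'"
    unfolding h_h'_def V_V'_def
    by (rule sym_bilinear_hform fin_dim_config_space subspace_config_space)+
  have T: "h' (extend_config F k s Z u) (extend_config F k s W w) = h Z W + 2 * s * (u \<bullet> w)"
    if "Z \<in> V" "W \<in> V" for s Z W u w
  proof -
    have "Z + W \<in> V" using that by (rule subspace_add[OF hs(3)])
    then show ?thesis
      using that unfolding h_h'_def hform_def extend_config_add[symmetric] V_V'_def
      by (simp add: action_extend_config[OF step n F_def[symmetric] F] inner_simps algebra_simps inner_commute)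
  qed
  have in': "extend_config F k s Z u \<in> V'" if "Z \<in> V" for s Z u
    using that unfolding V_V'_def by (rule extend_config_in_space)
  have "ind_on V h + CARD('d) \<le> ind_on V' h'"
    by (rule ind_on_extend[OF hs hs', where T = "extend_config F k (-1)"]) (simp_all add: T in')
  moreover have "coind_on V h + CARD('d) \<le> coind_on V' h'"
    unfolding coind_on_eq_ind_on
    by (rule ind_on_extend[OF sym_bilinear_uminus[OF hs(1)] hs(2,3) sym_bilinear_uminus[OF hs'(1)] hs'(2,3),
          where T = "extend_config F k 1"]) (simp_all add: T in')
  moreover have "dim (radical_on V' h') = dim (radical_on V h)"
    unfolding h_h'_def V_V'_def using nullity_hform[OF adm(1)] nullity_hform[OF adm(2)] end_eq by simp
  moreover have "dim V' \<le> dim V + 2 * CARD('d)"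
    unfolding V_V'_def by (rule dim_config_space_Suc)
  ultimately have "ind_on V' h' = ind_on V h + CARD('d) \<and> coind_on V' h' = coind_on V h + CARD('d)"
    using ind_coind_nullity[OF hs] ind_coind_nullity[OF hs'] by linarith
  then show "mas_at (Suc k) \<Gamma>' = mas_at k \<Gamma>" "comas_at (Suc k) \<Gamma>' = comas_at k \<Gamma>"
    unfolding mas_at_def comas_at_def h_h'_def V_V'_def by (simp_all add: algebra_simps)
qed

section \<open>Dependence on the subdivision and on the path\<close>

lemma symplectic_pathsD:
  assumes "\<Gamma> \<in> symplectic_paths"
  shows "continuous_on {0..1} \<Gamma>" "\<And>t. t \<in> {0..1} \<Longrightarrow> \<Gamma> t \<in> Sp" "\<Gamma> 0 = mat 1"
  using assms by (auto simp: symplectic_paths_def)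

text \<open>Trades the existence of generating functions for membership in an open set, as the
  compactness arguments require.\<close>

lemma large_enough_iff:
  assumes "\<Gamma> \<in> symplectic_paths"
  shows "large_enough \<Gamma> k \<longleftrightarrow> k \<ge> 1 \<and>
    (\<forall>t1\<in>{0..1}. \<forall>t2\<in>{0..1}. \<bar>t1 - t2\<bar> \<le> 1 / real k \<longrightarrow> (\<Gamma> t2, \<Gamma> t1) \<in> regular_pairs)"
proof -
  have "(\<exists>F. generates F (\<Gamma> t2 ** matrix_inv (\<Gamma> t1))) \<longleftrightarrow> (\<Gamma> t2, \<Gamma> t1) \<in> regular_pairs"
    if "t1 \<in> {0..1}" "t2 \<in> {0..1}" for t1 t2
  proof -
    have Sp: "\<Gamma> t1 \<in> Sp" "\<Gamma> t2 \<in> Sp" using symplectic_pathsD(2)[OF assms] that by auto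
    show ?thesis
      unfolding generated_iff[OF Sp_mult[OF Sp(2) Sp_matrix_inv[OF Sp(1)]]]
      by (simp add: regular_pairs_def transition_def Sp_det Sp)
  qed
  then show ?thesis unfolding large_enough_def by auto
qed

text \<open>The compact curve \<open>(\<Gamma> t, \<Gamma> t)\<close> lies in the open set
  \<open>regular_pairs\<close> with a uniform margin, and uniform continuity keeps
  \<open>(\<Gamma> t2, \<Gamma> t1)\<close> within that margin for close times.\<close>

lemma eventually_large_enough_index:
  assumes "\<Gamma> \<in> symplectic_paths"
  shows "\<exists>k0. \<forall>k\<ge>k0. large_enough \<Gamma> k"
proof -
  note \<Gamma> = symplectic_pathsD[OF assms]
  have "compact ((\<lambda>t. (\<Gamma> t, \<Gamma> t)) ` {0..1})"
    by (intro compact_continuous_image continuous_intros \<Gamma>) auto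
  then obtain e where e: "e > 0" "(\<Union>x\<in>(\<lambda>t. (\<Gamma> t, \<Gamma> t)) ` {0..1}. ball x e) \<subseteq> regular_pairs"
    by (rule compact_subset_open_imp_ball_epsilon_subset[OF _ open_regular_pairs])
       (auto intro!: regular_diag \<Gamma>)
  have "uniformly_continuous_on {0..1} \<Gamma>" by (intro compact_uniformly_continuous \<Gamma>) auto
  then obtain \<delta> where \<delta>: "\<delta> > 0" "\<And>s t. s \<in> {0..1} \<Longrightarrow> t \<in> {0..1} \<Longrightarrow> dist s t < \<delta> \<Longrightarrow> dist (\<Gamma> s) (\<Gamma> t) < e"
    using e(1) unfolding uniformly_continuous_on_def by metis
  obtain k0 :: nat where k0: "1 / \<delta> < real k0" using reals_Archimedean2 by blast
  have "large_enough \<Gamma> k" if "k \<ge> k0 + 1" for k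
    unfolding large_enough_iff[OF assms]
  proof (intro conjI ballI impI)
    show "1 \<le> k" using that by simp
    fix t1 t2 :: real assume t: "t1 \<in> {0..1}" "t2 \<in> {0..1}" "\<bar>t1 - t2\<bar> \<le> 1 / real k"
    have "1 / \<delta> < real k" using k0 that by linarith
    then have "1 / real k < \<delta>" using \<delta>(1) that by (simp add: field_simps)
    then have "dist (\<Gamma> t1) (\<Gamma> t2) < e" using t by (intro \<delta>(2)) (auto simp: dist_real_def)
    then have "(\<Gamma> t2, \<Gamma> t1) \<in> ball (\<Gamma> t1, \<Gamma> t1) e" by (simp add: dist_Pair_Pair)
    then show "(\<Gamma> t2, \<Gamma> t1) \<in> regular_pairs" using e(2) t(1) by blast
  qed
  then show ?thesis by blast
qed

text \<open>\<open>large_enough\<close> controls all pairs of times at distance at most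
  \<open>1/k\<close>, in either order, so any sampling with increments this small is admissible,
  whatever the number \<open>m\<close> of samples.\<close>

lemma admissible_resample:
  assumes \<Gamma>: "\<Gamma> \<in> symplectic_paths" "large_enough \<Gamma> k" and m: "m \<ge> 1"
    and \<tau>: "\<tau> 0 = 0" "\<And>j. j \<le> m \<Longrightarrow> \<tau> (real j / real m) \<in> {0..1}"
      "\<And>j. j < m \<Longrightarrow> \<bar>\<tau> (real (Suc j) / real m) - \<tau> (real j / real m)\<bar> \<le> 1 / real k"
  shows "admissible m (\<lambda>u. \<Gamma> (\<tau> u))"
  unfolding admissible_def
proof (intro conjI allI impI)
  fix j assume j: "j < m"
  then show "(\<Gamma> (\<tau> (real (Suc j) / real m)), \<Gamma> (\<tau> (real j / real m))) \<in> regular_pairs"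
    using \<Gamma>(2) \<tau>(2)[of j] \<tau>(2)[of "Suc j"] \<tau>(3)[OF j] unfolding large_enough_iff[OF \<Gamma>(1)]
    by (auto simp: abs_minus_commute simp del: of_nat_Suc)
qed (use m \<tau> symplectic_pathsD[OF \<Gamma>(1)] in auto)

lemma admissible_large_enough:
  assumes "\<Gamma> \<in> symplectic_paths" "large_enough \<Gamma> k"
  shows "admissible k \<Gamma>"
proof -
  have k: "k \<ge> 1" using assms(2) by (simp add: large_enough_def)
  show ?thesis
    using admissible_resample[OF assms k, of "\<lambda>u. u"] k by (simp add: diff_divide_distrib[symmetric])
qed

section \<open>Independence of the subdivision\<close>

lemma hform_cong:
  assumes "\<And>j. j < k \<Longrightarrow> step_mat \<Gamma> k j = step_mat \<Gamma>' k j"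
  shows "hform \<Gamma> k = hform \<Gamma>' k"
  unfolding hform_def action_def using assms by (intro ext) simp

text \<open>The first \<open>k\<close> steps of mesh \<open>1/k\<close>, followed by \<open>m - k\<close> constant steps.\<close>

definition padded :: "nat \<Rightarrow> nat \<Rightarrow> real \<Rightarrow> real" where
  "padded k m u = min (real m * u / real k) 1"

lemma padded_grid:
  assumes "m \<ge> 1"
  shows "padded k m (real j / real m) = min (real j / real k) 1"
  using assms by (simp add: padded_def)

lemma padded_mesh:
  assumes "m \<ge> 1" "k \<ge> 1"
  shows "\<bar>padded k m (real (Suc j) / real m) - padded k m (real j / real m)\<bar> \<le> 1 / real k"
proof -
  have "real (Suc j) / real k = real j / real k + 1 / real k" by (simp add: add_divide_distrib)
  moreover have "0 \<le> 1 / real k" by simp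
  ultimately show ?thesis unfolding padded_grid[OF assms(1)] by linarith
qed

text \<open>At grid index \<open>j\<close> the padded time is \<open>min (j/k) 1\<close>, whatever
  \<open>m\<close> is. Passing from \<open>m\<close> to \<open>Suc m\<close> therefore keeps the
  first \<open>m\<close> steps and appends one constant step.\<close>

lemma mas_at_padded:
  assumes \<Gamma>: "\<Gamma> \<in> symplectic_paths" "large_enough \<Gamma> k" and "m \<ge> k"
  shows "mas_at m (\<lambda>u. \<Gamma> (padded k m u)) = mas_at k \<Gamma> \<and>
    comas_at m (\<lambda>u. \<Gamma> (padded k m u)) = comas_at k \<Gamma>"
  using \<open>m \<ge> k\<close>
proof (induction m rule: dec_induct)
  case base
  have k: "k \<ge> 1" using \<Gamma>(2) by (simp add: large_enough_def)
  have "hform (\<lambda>u. \<Gamma> (padded k k u)) k = hform \<Gamma> k"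
    by (rule hform_cong) (simp add: step_mat_def padded_grid k min_absorb1 del: of_nat_Suc of_nat_add)
  then show ?case by (simp add: mas_at_def comas_at_def)
next
  case (step m)
  have k: "k \<ge> 1" using \<Gamma>(2) by (simp add: large_enough_def)
  then have m: "m \<ge> 1" using step.hyps by simp
  have adm: "admissible n (\<lambda>u. \<Gamma> (padded k n u))" if "n \<ge> 1" for n
    using padded_mesh[OF that k]
    by (intro admissible_resample[OF \<Gamma> that]) (auto simp: padded_grid[OF that], simp add: padded_def)
  have stp: "step_mat (\<lambda>u. \<Gamma> (padded k n u)) n j =
      transition (\<Gamma> (min (real (Suc j) / real k) 1), \<Gamma> (min (real j / real k) 1))" if "n \<ge> 1" for n j
    unfolding step_mat_transition padded_grid[OF that] ..
  have "\<Gamma> 1 \<in> Sp" using symplectic_pathsD(2)[OF \<Gamma>(1), of 1] by simp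
  then have last: "step_mat (\<lambda>u. \<Gamma> (padded k (Suc m) u)) (Suc m) m = mat 1"
    using step.hyps k by (simp add: stp min_absorb2 transition_diag del: of_nat_Suc)
  have end1: "padded k n 1 = 1" if "n \<ge> k" for n
    using that k by (simp add: padded_def min_absorb2)
  have "mas_at (Suc m) (\<lambda>u. \<Gamma> (padded k (Suc m) u)) = mas_at m (\<lambda>u. \<Gamma> (padded k m u))"
    "comas_at (Suc m) (\<lambda>u. \<Gamma> (padded k (Suc m) u)) = comas_at m (\<lambda>u. \<Gamma> (padded k m u))"
    by (rule mas_at_append_identity; use adm m last step.hyps in \<open>simp add: stp end1 del: of_nat_Suc\<close>)+
  then show ?case using step.IH by simp
qed

text \<open>Interpolate linearly between the padded and the uniform subdivision: the mesh stays at most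
  \<open>1/k\<close>, and the nullity stays \<open>dim (ker (\<Gamma> 1 - I))\<close>.\<close>

lemma mas_at_refinement:
  assumes \<Gamma>: "\<Gamma> \<in> symplectic_paths" "large_enough \<Gamma> k" and mk: "m \<ge> k"
  shows "mas_at m \<Gamma> = mas_at k \<Gamma> \<and> comas_at m \<Gamma> = comas_at k \<Gamma>"
proof -
  have k: "k \<ge> 1" using \<Gamma>(2) by (simp add: large_enough_def)
  then have m: "m \<ge> 1" using mk by simp
  define \<tau> where "\<tau> s u = (1 - s) * padded k m u + s * u" for s u :: real
  define G where "G s u = \<Gamma> (\<tau> s u)" for s u
  have \<tau>01: "\<tau> s (real j / real m) \<in> {0..1}" if "s \<in> {0..1}" "j \<le> m" for s j
  proof -
    have "padded k m (real j / real m) \<in> {0..1}" "real j / real m \<in> {0..1}"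
      using that m by (simp_all add: padded_grid)
    from convexD_alt[OF _ this, of s] show ?thesis
      using that by (simp add: \<tau>_def)
  qed
  have mesh: "\<bar>\<tau> s (real (Suc j) / real m) - \<tau> s (real j / real m)\<bar> \<le> 1 / real k" if s: "s \<in> {0..1}" for s j
  proof -
    let ?a = "padded k m (real (Suc j) / real m) - padded k m (real j / real m)"
    let ?b = "real (Suc j) / real m - real j / real m"
    have "?b = 1 / real m" by (simp add: diff_divide_distrib[symmetric])
    also have "\<dots> \<le> 1 / real k" using mk k by (simp add: frac_le)
    finally have b: "\<bar>?b\<bar> \<le> 1 / real k" using \<open>?b = 1 / real m\<close> by simp
    have "\<tau> s (real (Suc j) / real m) - \<tau> s (real j / real m) = (1 - s) * ?a + s * ?b"
      unfolding \<tau>_def by (simp add: algebra_simps del: of_nat_Suc)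
    also have "\<bar>\<dots>\<bar> \<le> (1 - s) * \<bar>?a\<bar> + s * \<bar>?b\<bar>"
      using s by (intro order_trans[OF abs_triangle_ineq]) (simp add: abs_mult del: of_nat_Suc)
    also have "\<dots> \<le> (1 - s) * (1 / real k) + s * (1 / real k)"
      using s b padded_mesh[OF m k, of j] by (intro add_mono mult_left_mono) auto
    also have "\<dots> = 1 / real k" by (simp add: add_divide_distrib[symmetric])
    finally show ?thesis .
  qed
  have adm: "admissible m (G s)" if "s \<in> {0..1}" for s
    unfolding G_def using \<tau>01 mesh that
    by (intro admissible_resample[OF \<Gamma> m]) (auto simp: \<tau>_def padded_def)
  have G1: "G s 1 = \<Gamma> 1" for s
    using mk k by (simp add: G_def \<tau>_def padded_def min_absorb2)
  have lim: "((\<lambda>s. G s (real j / real m)) \<longlongrightarrow> G s0 (real j / real m)) (at s0 within {0..1})"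
    if "s0 \<in> {0..1}" "j \<le> m" for s0 j
  proof -
    have "continuous_on {0..1} (\<lambda>s. G s (real j / real m))"
      unfolding G_def
    proof (rule continuous_on_compose2[OF symplectic_pathsD(1)[OF \<Gamma>(1)]])
      show "continuous_on {0..1} (\<lambda>s. \<tau> s (real j / real m))"
        unfolding \<tau>_def by (intro continuous_intros)
    qed (use \<tau>01 that in blast)
    then show ?thesis using that(1) by (simp add: continuous_on_def)
  qed
  \<comment> \<open>Both indices are treated as one pair, locally constant in \<open>s\<close> and
    hence constant on the connected parameter interval.\<close>
  have "(mas_at m (G 0), comas_at m (G 0)) = (mas_at m (G 1), comas_at m (G 1))"
  proof (rule connected_local_const[where A = "{0..1::real}"])
    show "\<forall>s0\<in>{0..1}. eventually (\<lambda>s. (mas_at m (G s0), comas_at m (G s0)) = (mas_at m (G s), comas_at m (G s)))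
        (at s0 within {0..1})"
    proof
      fix s0 :: real assume s0: "s0 \<in> {0..1}"
      have "eventually (\<lambda>s. mas_at m (G s) = mas_at m (G s0) \<and> comas_at m (G s) = comas_at m (G s0)) (at s0 within {0..1})"
        using lim[OF s0] adm
        by (intro mas_at_locally_constant adm[OF s0]) (auto simp: G1 eventually_at_filter)
      then show "eventually (\<lambda>s. (mas_at m (G s0), comas_at m (G s0)) = (mas_at m (G s), comas_at m (G s)))
        (at s0 within {0..1})"
        by eventually_elim simp
    qed
  qed auto
  moreover have "G 0 = (\<lambda>u. \<Gamma> (padded k m u))" "G 1 = \<Gamma>" by (auto simp: G_def \<tau>_def)
  ultimately show ?thesis using mas_at_padded[OF \<Gamma> mk] by simp
qed

text \<open>Of two large enough parameters either may be the larger;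
  \<open>mas_at_refinement\<close> compares any \<open>m \<ge> k\<close>, divisible or not, so it
  applies to the chosen and the given one directly.\<close>

lemma mas_eq_mas_at:
  assumes "\<Gamma> \<in> symplectic_paths" "large_enough \<Gamma> k"
  shows "mas \<Gamma> = mas_at k \<Gamma>" "comas \<Gamma> = comas_at k \<Gamma>"
proof -
  define k' where "k' = (SOME k. large_enough \<Gamma> k)"
  have "large_enough \<Gamma> k'" unfolding k'_def using assms(2) by (rule someI)
  then have "mas_at k' \<Gamma> = mas_at k \<Gamma> \<and> comas_at k' \<Gamma> = comas_at k \<Gamma>"
    using mas_at_refinement[OF assms(1)] assms(2) by (metis nle_le)
  then show "mas \<Gamma> = mas_at k \<Gamma>" "comas \<Gamma> = comas_at k \<Gamma>"
    by (simp_all add: mas_def comas_def k'_def)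
qed

section \<open>Neighbourhoods in the space of paths\<close>

lemma topspace_path_topology [simp]: "topspace path_topology = symplectic_paths"
  by (auto simp: path_topology_def symplectic_paths_def)

lemma eventually_uniformly_close:
  fixes \<Gamma> :: "real \<Rightarrow> 'd::finite phase_mat"
  assumes \<Gamma>: "\<Gamma> \<in> symplectic_paths" and e: "e > 0"
  shows "eventually (\<lambda>\<Delta>. \<Delta> \<in> symplectic_paths \<and> (\<forall>t\<in>{0..1}. dist (\<Gamma> t) (\<Delta> t) < e)) (nhdsin path_topology \<Gamma>)"
proof -
  define m :: "(real \<Rightarrow> 'd phase_mat) metric" where "m = cfunspace (top_of_set {0..1}) euclidean_metric"
  interpret Metric_space "mspace m" "mdist m" by (rule Metric_space_mspace_mdist)
  have sub: "symplectic_paths \<subseteq> mspace m" by (auto simp: symplectic_paths_def m_def)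
  \<comment> \<open>The supremum distance gives only a non-strict pointwise bound; radius
    \<open>e/2\<close> turns it into a strict one.\<close>
  have "openin path_topology (symplectic_paths \<inter> mball \<Gamma> (e/2))"
    unfolding path_topology_def m_def[symmetric] mtopology_of_def
    by (metis Int_commute openin_mball openin_subtopology_Int)
  moreover have "\<Gamma> \<in> symplectic_paths \<inter> mball \<Gamma> (e/2)" using \<Gamma> sub e by auto
  moreover have "dist (\<Gamma> t) (\<Delta> t) < e" if "\<Delta> \<in> mball \<Gamma> (e/2)" "t \<in> {0..1}" for \<Delta> t
  proof -
    have "\<Gamma> \<in> mspace m" "\<Delta> \<in> mspace m" "mdist m \<Gamma> \<Delta> \<le> e/2" using that(1) by auto
    then have "mdist euclidean_metric (\<Gamma> t) (\<Delta> t) \<le> e/2"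
      unfolding m_def by (rule mdist_cfunspace_imp_mdist_le) (use that(2) in simp)
    then show ?thesis using e by simp
  qed
  ultimately show ?thesis unfolding eventually_nhdsin by blast
qed

text \<open>The pairs \<open>(\<Gamma> t2, \<Gamma> t1)\<close> with times at most
  \<open>1/k\<close> apart form a compact subset of an open set; a uniform margin around it absorbs
  small perturbations of the path.\<close>

lemma eventually_large_enough_near:
  fixes \<Gamma> :: "real \<Rightarrow> 'd::finite phase_mat"
  assumes \<Gamma>: "\<Gamma> \<in> symplectic_paths" "large_enough \<Gamma> k"
  shows "eventually (\<lambda>\<Delta>. \<Delta> \<in> symplectic_paths \<and> large_enough \<Delta> k) (nhdsin path_topology \<Gamma>)"
proof -
  note cont = symplectic_pathsD(1)[OF \<Gamma>(1)]
  define K where "K = {p \<in> {0..1} \<times> {0..1}. \<bar>fst p - snd p\<bar> \<le> 1 / real k}"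
  have "K = ({0..1} \<times> {0..1}) \<inter> {p. \<bar>fst p - snd p\<bar> \<le> 1 / real k}" by (auto simp: K_def)
  then have "compact K"
    by (auto intro!: compact_Int_closed compact_Times closed_Collect_le continuous_intros)
  then have "compact ((\<lambda>p. (\<Gamma> (snd p), \<Gamma> (fst p))) ` K)"
    by (intro compact_continuous_image continuous_on_Pair continuous_on_compose2[OF cont] continuous_intros)
       (auto simp: K_def)
  moreover have "(\<lambda>p. (\<Gamma> (snd p), \<Gamma> (fst p))) ` K \<subseteq> regular_pairs"
    using \<Gamma>(2) unfolding large_enough_iff[OF \<Gamma>(1)] by (auto simp: K_def)
  ultimately obtain e where e: "e > 0" "(\<Union>x\<in>(\<lambda>p. (\<Gamma> (snd p), \<Gamma> (fst p))) ` K. ball x e) \<subseteq> regular_pairs"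
    by (rule compact_subset_open_imp_ball_epsilon_subset[OF _ open_regular_pairs])
  \<comment> \<open>If both coordinates move by less than \<open>e/2\<close>, the pair moves by less
    than \<open>e\<close>.\<close>
  have "eventually (\<lambda>\<Delta>. \<Delta> \<in> symplectic_paths \<and> (\<forall>t\<in>{0..1}. dist (\<Gamma> t) (\<Delta> t) < e/2)) (nhdsin path_topology \<Gamma>)"
    using e(1) by (intro eventually_uniformly_close \<Gamma>) simp
  then show ?thesis
  proof eventually_elim
    case (elim \<Delta>)
    have "(\<Delta> t2, \<Delta> t1) \<in> regular_pairs"
      if t: "t1 \<in> {0..1}" "t2 \<in> {0..1}" "\<bar>t1 - t2\<bar> \<le> 1 / real k" for t1 t2
    proof -
      have "dist (\<Gamma> t2, \<Gamma> t1) (\<Delta> t2, \<Delta> t1) \<le> dist (\<Gamma> t2) (\<Delta> t2) + dist (\<Gamma> t1) (\<Delta> t1)"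
        unfolding dist_Pair_Pair by (rule sqrt_sum_squares_le_sum) auto
      also have "\<dots> < e/2 + e/2" using elim t by (intro add_strict_mono) auto
      finally have "(\<Delta> t2, \<Delta> t1) \<in> ball (\<Gamma> t2, \<Gamma> t1) e" by simp
      moreover have "(\<Gamma> t2, \<Gamma> t1) \<in> (\<lambda>p. (\<Gamma> (snd p), \<Gamma> (fst p))) ` K"
        using t by (intro image_eqI[of _ _ "(t1, t2)"]) (auto simp: K_def)
      ultimately show ?thesis using e(2) by blast
    qed
    moreover have "k \<ge> 1" using \<Gamma>(2) by (simp add: large_enough_def)
    ultimately show ?case using elim large_enough_iff[of \<Delta> k] by auto
  qed
qed

lemma evaluation_tendsto:
  fixes \<Gamma> :: "real \<Rightarrow> 'd::finite phase_mat"
  assumes "\<Gamma> \<in> symplectic_paths" "t \<in> {0..1}"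
  shows "((\<lambda>\<Delta>. \<Delta> t) \<longlongrightarrow> \<Gamma> t) (nhdsin path_topology \<Gamma>)"
proof (rule tendstoI)
  fix e :: real assume "e > 0"
  from eventually_uniformly_close[OF assms(1) this]
  show "eventually (\<lambda>\<Delta>. dist (\<Delta> t) (\<Gamma> t) < e) (nhdsin path_topology \<Gamma>)"
    by eventually_elim (use assms(2) in \<open>simp add: dist_commute\<close>)
qed

lemma mas_semicontinuous_near:
  fixes \<Gamma> :: "real \<Rightarrow> 'd::finite phase_mat"
  assumes \<Gamma>: "\<Gamma> \<in> symplectic_paths"
  shows "eventually (\<lambda>\<Delta>. mas \<Gamma> \<le> mas \<Delta>) (nhdsin path_topology \<Gamma>)"
    "eventually (\<lambda>\<Delta>. comas \<Gamma> \<le> comas \<Delta>) (nhdsin path_topology \<Gamma>)"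
    "eventually (\<lambda>\<Delta>. dim {v. (\<Delta> 1 - mat 1) *v v = 0} = dim {v. (\<Gamma> 1 - mat 1) *v v = 0}
       \<longrightarrow> mas \<Delta> = mas \<Gamma> \<and> comas \<Delta> = comas \<Gamma>) (nhdsin path_topology \<Gamma>)"
proof -
  let ?N = "nhdsin path_topology \<Gamma>"
  let ?null = "\<lambda>\<Delta>. dim {v. (\<Delta> 1 - mat 1) *v v = 0} = dim {v. (\<Gamma> 1 - mat 1) *v v = 0}"
  obtain k where k: "large_enough \<Gamma> k" using eventually_large_enough_index[OF \<Gamma>] by blast
  have le: "eventually (\<lambda>\<Delta>. \<Delta> \<in> symplectic_paths \<and> large_enough \<Delta> k) ?N"
    by (rule eventually_large_enough_near[OF \<Gamma> k])
  then have adm: "eventually (\<lambda>\<Delta>. admissible k \<Delta>) ?N"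
    by eventually_elim (simp add: admissible_large_enough)
  have lim: "((\<lambda>\<Delta>. \<Delta> (real j / real k)) \<longlongrightarrow> \<Gamma> (real j / real k)) ?N" if "j \<le> k" for j
    using that by (intro evaluation_tendsto \<Gamma>) (auto simp: divide_le_eq_1)
  note adm0 = admissible_large_enough[OF \<Gamma> k]
  have at: "eventually (\<lambda>\<Delta>. mas_at k \<Gamma> \<le> mas_at k \<Delta>) ?N"
    "eventually (\<lambda>\<Delta>. comas_at k \<Gamma> \<le> comas_at k \<Delta>) ?N"
    by (intro mas_at_lower_semicontinuous adm0 adm lim; assumption)+
  show "eventually (\<lambda>\<Delta>. mas \<Gamma> \<le> mas \<Delta>) ?N"
    using le at(1)
    by eventually_elim (simp add: mas_eq_mas_at[OF \<Gamma> k] mas_eq_mas_at[where k = k])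
  show "eventually (\<lambda>\<Delta>. comas \<Gamma> \<le> comas \<Delta>) ?N"
    using le at(2)
    by eventually_elim (simp add: mas_eq_mas_at[OF \<Gamma> k] mas_eq_mas_at[where k = k])
  \<comment> \<open>Restricting the filter to paths of the same nullity turns that condition into an
    eventual one, as \<open>mas_at_locally_constant\<close> expects; afterwards it is read back as
    an implication.\<close>
  let ?M = "inf ?N (principal {\<Delta>. ?null \<Delta>})"
  have "eventually (\<lambda>\<Delta>. mas_at k \<Delta> = mas_at k \<Gamma> \<and> comas_at k \<Delta> = comas_at k \<Gamma>) ?M"
  proof (rule mas_at_locally_constant[OF adm0])
    show "eventually (\<lambda>\<Delta>. admissible k \<Delta>) ?M" "eventually ?null ?M"
      using adm by (auto simp: eventually_inf_principal elim: eventually_mono)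
    show "((\<lambda>\<Delta>. \<Delta> (real j / real k)) \<longlongrightarrow> \<Gamma> (real j / real k)) ?M" if "j \<le> k" for j
      using lim[OF that] by (rule tendsto_mono[rotated]) simp
  qed
  then have "eventually (\<lambda>\<Delta>. ?null \<Delta> \<longrightarrow> mas_at k \<Delta> = mas_at k \<Gamma> \<and> comas_at k \<Delta> = comas_at k \<Gamma>) ?N"
    by (simp add: eventually_inf_principal)
  with le show "eventually (\<lambda>\<Delta>. ?null \<Delta> \<longrightarrow> mas \<Delta> = mas \<Gamma> \<and> comas \<Delta> = comas \<Gamma>) ?N"
    by eventually_elim (simp add: mas_eq_mas_at[OF \<Gamma> k] mas_eq_mas_at[where k = k])
qed

text \<open>For integer values, lower semicontinuity at a point means that the value there is a
  local minimum: with \<open>x\<close>, the set where \<open>a < f\<close> contains a neighbourhood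
  on which \<open>f\<close> is at least \<open>f x\<close>.\<close>

lemma lower_semicontinuous_mapI:
  assumes "\<And>x. x \<in> topspace T \<Longrightarrow> eventually (\<lambda>y. f x \<le> f y) (nhdsin T x)"
  shows "lower_semicontinuous_map T f"
  unfolding lower_semicontinuous_map_def
proof
  fix a
  show "openin T {x \<in> topspace T. a < f x}"
  proof (subst openin_subopen, intro ballI)
    fix x assume x: "x \<in> {x \<in> topspace T. a < f x}"
    then obtain S where S: "openin T S" "x \<in> S" "\<forall>y\<in>S. f x \<le> f y"
      using assms[of x] by (auto simp: eventually_nhdsin)
    then have "S \<subseteq> {x \<in> topspace T. a < f x}" using openin_subset[OF S(1)] x by force
    with S show "\<exists>S. openin T S \<and> x \<in> S \<and> S \<subseteq> {x \<in> topspace T. a < f x}" by blast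
  qed
qed

lemma locally_constant_map_subtopologyI:
  assumes "\<And>x. x \<in> topspace T \<inter> A \<Longrightarrow> eventually (\<lambda>y. y \<in> A \<longrightarrow> f y = f x) (nhdsin T x)"
  shows "locally_constant_map (subtopology T A) f"
  unfolding locally_constant_map_def
proof
  fix x assume x: "x \<in> topspace (subtopology T A)"
  then obtain S where S: "openin T S" "x \<in> S" "\<forall>y\<in>S. y \<in> A \<longrightarrow> f y = f x"
    using assms[of x] by (auto simp: eventually_nhdsin)
  have "openin (subtopology T A) (S \<inter> A)" using S(1) by (rule openin_subtopology_Int)
  moreover have "x \<in> S \<inter> A" using S(2) x by simp
  moreover have "\<forall>y\<in>S \<inter> A. f y = f x" using S(3) by blast
  ultimately show "\<exists>U. openin (subtopology T A) U \<and> x \<in> U \<and> (\<forall>y\<in>U. f y = f x)"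
    by blast
qed

theorem theorem3p3:
  shows "(\<forall>\<Gamma> \<in> (symplectic_paths :: (real \<Rightarrow> 'd::finite phase_mat) set).
            (\<exists>k0. \<forall>k\<ge>k0. large_enough \<Gamma> k) \<and>
            (\<forall>k. large_enough \<Gamma> k \<longrightarrow> mas \<Gamma> = mas_at k \<Gamma> \<and> comas \<Gamma> = comas_at k \<Gamma>))
       \<and> lower_semicontinuous_map (path_topology :: (real \<Rightarrow> 'd phase_mat) topology) mas
       \<and> lower_semicontinuous_map (path_topology :: (real \<Rightarrow> 'd phase_mat) topology) comas
       \<and> (\<forall>n \<le> 2 * CARD('d).
            locally_constant_map
              (subtopology path_topology (symplectic_paths_nullity n :: (real \<Rightarrow> 'd phase_mat) set)) mas \<and>
            locally_constant_map
              (subtopology path_topology (symplectic_paths_nullity n :: (real \<Rightarrow> 'd phase_mat) set)) comas)"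
proof (intro conjI ballI allI impI)
  fix \<Gamma> :: "real \<Rightarrow> 'd phase_mat" assume \<Gamma>: "\<Gamma> \<in> symplectic_paths"
  show "\<exists>k0. \<forall>k\<ge>k0. large_enough \<Gamma> k" by (rule eventually_large_enough_index[OF \<Gamma>])
  fix k assume k: "large_enough \<Gamma> k"
  show "mas \<Gamma> = mas_at k \<Gamma>" "comas \<Gamma> = comas_at k \<Gamma>"
    by (rule mas_eq_mas_at[OF \<Gamma> k])+
next
  show "lower_semicontinuous_map (path_topology :: (real \<Rightarrow> 'd phase_mat) topology) mas"
    "lower_semicontinuous_map (path_topology :: (real \<Rightarrow> 'd phase_mat) topology) comas"
    by (rule lower_semicontinuous_mapI, rule mas_semicontinuous_near, simp)+
next
  fix n :: nat
  have ev: "eventually (\<lambda>\<Delta>. \<Delta> \<in> symplectic_paths_nullity n \<longrightarrow> mas \<Delta> = mas \<Gamma> \<and> comas \<Delta> = comas \<Gamma>)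
      (nhdsin path_topology \<Gamma>)"
    if "\<Gamma> \<in> symplectic_paths_nullity n" for \<Gamma> :: "real \<Rightarrow> 'd phase_mat"
  proof -
    have \<Gamma>: "\<Gamma> \<in> symplectic_paths" "dim {v. (\<Gamma> 1 - mat 1) *v v = 0} = n"
      using that by (auto simp: symplectic_paths_nullity_def)
    show ?thesis
      using mas_semicontinuous_near(3)[OF \<Gamma>(1)] unfolding \<Gamma>(2)
      by eventually_elim (simp add: symplectic_paths_nullity_def)
  qed
  show "locally_constant_map
        (subtopology path_topology (symplectic_paths_nullity n :: (real \<Rightarrow> 'd phase_mat) set)) mas"
      "locally_constant_map
        (subtopology path_topology (symplectic_paths_nullity n :: (real \<Rightarrow> 'd phase_mat) set)) comas"
    by (rule locally_constant_map_subtopologyI, rule eventually_mono[OF ev], auto)+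
qed

end
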